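(* Fix $0<\epsilon<1$, and let $(\mathcal{N}_d)_d$ be a family of random unitary channels indexed by (arbitrarily large) dimensions $d$, where $\mathcal{N}_d$ acts on density operators on $\mathbb{C}^d$ as $\mathcal{N}_d(\rho)=\frac1n\sum_{i=1}^n V_i\rho V_i^\dagger$ with $V_1,\dots,V_n$ unitary on $\mathbb{C}^d$ and $n=n(d)=\lceil 134\, d\ln d/\epsilon^2\rceil$, and where each $\mathcal{N}_d$ is $\epsilon$-randomizing. Let $\overline{\mathcal{N}_d}(\rho)=\frac1n\sum_{i=1}^n \overline{V_i}\rho\,\overline{V_i}^\dagger$. Then for every $p>2$ and all sufficiently large $d$ in the family, $$\nu_p(\mathcal{N}_d)\,\nu_p(\overline{\mathcal{N}_d})\;\le\;\left(\frac{1+\epsilon}{d}\right)^{2-2/p}\;<\;\frac1n\;\le\;\nu_p(\mathcal{N}_d\otimes\overline{\mathcal{N}_d}),$$ and moreover $n\left(\frac{1+\epsilon}{d}\right)^{2-2/p}\to 0$ as $d\to\infty$. In particular the maximal output $p$-norm is strictly supermultiplicative, $\nu_p(\mathcal{N}_d\otimes\overline{\mathcal{N}_d})>\nu_p(\mathcal{N}_d)\nu_p(\overline{\mathcal{N}_d})$, for all sufficiently large $d$.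
   Context: For a matrix $\sigma$ and $p>1$, $\|\sigma\|_p=(\mathrm{Tr}|\sigma|^p)^{1/p}$ is the Schatten $p$-norm and $\|\sigma\|_\infty$ is the operator norm. For a quantum channel (completely positive trace-preserving map) $\mathcal{N}$ and $p>1$, the maximal output $p$-norm is $\nu_p(\mathcal{N})=\sup\{\|\mathcal{N}(\rho)\|_p:\rho\ge0,\ \mathrm{Tr}\rho=1\}$. A channel $\mathcal{N}$ on $\mathbb{C}^d$ of the form $\rho\mapsto\frac1n\sum_{i=1}^nV_i\rho V_i^\dagger$ with unitary $V_i$ is called $\epsilon$-randomizing if $\left\|\mathcal{N}(\rho)-\frac1d I\right\|_\infty\le\frac{\epsilon}{d}$ for all density operators $\rho$ on $\mathbb{C}^d$. $\overline{V}$ denotes entrywise complex conjugation in a fixed orthonormal basis. *)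

theory Defs
  imports
    Complex_Main
    "Jordan_Normal_Form.Schur_Decomposition"
begin

text \<open>
  Operators on \<open>\<complex>\<^sup>d\<close> are complex matrices in \<^term>\<open>carrier_mat d d\<close>; the identification
  \<open>\<complex>\<^sup>d \<otimes> \<complex>\<^sup>e = \<complex>\<^sup>d\<^sup>e\<close> pairs the indices \<open>(i, k)\<close> into \<open>i * e + k\<close>.
\<close>

definition mtrace :: "complex mat \<Rightarrow> complex" where
  "mtrace A = (\<Sum>i<dim_row A. A $$ (i, i))"

definition unitary_mat :: "nat \<Rightarrow> complex mat \<Rightarrow> bool" where
  "unitary_mat d U \<longleftrightarrow> U \<in> carrier_mat d d \<and>
     U * mat_adjoint U = 1\<^sub>m d \<and> mat_adjoint U * U = 1\<^sub>m d"

text \<open>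
  The order on \<^typ>\<open>complex\<close> is the partial one: \<open>0 \<le> z\<close> says that \<open>z\<close> is real and nonnegative.
  In particular a positive semidefinite matrix is Hermitian.
\<close>

definition psd_mat :: "nat \<Rightarrow> complex mat \<Rightarrow> bool" where
  "psd_mat d A \<longleftrightarrow> A \<in> carrier_mat d d \<and> (\<forall>v\<in>carrier_vec d. 0 \<le> (A *\<^sub>v v) \<bullet>c v)"

definition density_ops :: "nat \<Rightarrow> complex mat set" where
  "density_ops d = {\<rho>. psd_mat d \<rho> \<and> mtrace \<rho> = 1}"

definition l2_norm :: "complex vec \<Rightarrow> real" where
  "l2_norm v = sqrt (\<Sum>i<dim_vec v. (cmod (v $ i))\<^sup>2)"

definition op_norm :: "complex mat \<Rightarrow> real" where
  "op_norm A = (SUP v \<in> {v \<in> carrier_vec (dim_col A). l2_norm v = 1}. l2_norm (A *\<^sub>v v))"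

text \<open>
  Functional calculus for Hermitian matrices: \<open>A = U diag(l) U\<^sup>\<dagger>\<close> is sent to \<open>U diag(f l) U\<^sup>\<dagger>\<close>.
  The result does not depend on the diagonalisation (lemma \<open>spectral_unique\<close>).
\<close>

definition spectral_form :: "complex mat \<Rightarrow> complex mat \<Rightarrow> (nat \<Rightarrow> real) \<Rightarrow> bool" where
  "spectral_form A U l \<longleftrightarrow> unitary_mat (dim_row A) U \<and>
     A = U * mat_diag (dim_row A) (\<lambda>i. complex_of_real (l i)) * mat_adjoint U"

lemma spectral_unique:
  assumes U: "spectral_form A U l" and V: "spectral_form A V m"
  shows "U * mat_diag (dim_row A) (\<lambda>i. complex_of_real (f (l i))) * mat_adjoint U
       = V * mat_diag (dim_row A) (\<lambda>i. complex_of_real (f (m i))) * mat_adjoint V"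
proof -
  let ?d = "dim_row A"
  let ?D = "\<lambda>h. mat_diag ?d (\<lambda>i. complex_of_real (h i))"
  have adj: "mat_adjoint X \<in> carrier_mat ?d ?d" if "X \<in> carrier_mat ?d ?d" for X :: "complex mat"
    using that unfolding mat_adjoint_def by (auto simp: mat_of_rows_def)
  have cU: "U \<in> carrier_mat ?d ?d" "mat_adjoint U \<in> carrier_mat ?d ?d"
    and cV: "V \<in> carrier_mat ?d ?d" "mat_adjoint V \<in> carrier_mat ?d ?d"
    and iU: "U * mat_adjoint U = 1\<^sub>m ?d" "mat_adjoint U * U = 1\<^sub>m ?d"
    and iV: "V * mat_adjoint V = 1\<^sub>m ?d" "mat_adjoint V * V = 1\<^sub>m ?d"
    using U V adj unfolding spectral_form_def unitary_mat_def by blast+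
  have cD: "?D h \<in> carrier_mat ?d ?d" for h by simp
  have AU: "A = U * ?D l * mat_adjoint U" and AV: "A = V * ?D m * mat_adjoint V"
    using U V unfolding spectral_form_def by blast+
  define W where "W = mat_adjoint V * U"
  have cW: "W \<in> carrier_mat ?d ?d" unfolding W_def using cU cV by auto
  note assoc = assoc_mult_mat[of _ ?d ?d _ ?d _ ?d] mult_carrier_mat[of _ ?d ?d _ ?d]
  have VW: "V * W = U"
  proof -
    have "V * W = (V * mat_adjoint V) * U" unfolding W_def using cU cV by (simp add: assoc)
    then show ?thesis using iV cU by simp
  qed
  have WU: "W * mat_adjoint U = mat_adjoint V"
  proof -
    have "W * mat_adjoint U = mat_adjoint V * (U * mat_adjoint U)"
      unfolding W_def using cU cV by (simp add: assoc)
    then show ?thesis using iU cV by simp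
  qed
  have "mat_adjoint V * A * U = W * ?D l * (mat_adjoint U * U)"
    by (subst AU) (use cU cV cD in \<open>simp add: W_def assoc\<close>)
  then have 1: "mat_adjoint V * A * U = W * ?D l"
    using iU right_mult_one_mat[OF mult_carrier_mat[OF cW cD]] by simp
  have "mat_adjoint V * A * U = (mat_adjoint V * V) * ?D m * W"
    by (subst AV) (use cU cV cD in \<open>simp add: W_def assoc\<close>)
  then have 2: "mat_adjoint V * A * U = ?D m * W" using iV left_mult_one_mat[OF cD] by simp
  have e: "W * ?D l = ?D m * W" using 1 2 by simp
  have f: "W * ?D (\<lambda>i. f (l i)) = ?D (\<lambda>i. f (m i)) * W"
  proof (rule eq_matI)
    fix i j
    assume "i < dim_row (?D (\<lambda>i. f (m i)) * W)" "j < dim_col (?D (\<lambda>i. f (m i)) * W)"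
    then have ij: "i < ?d" "j < ?d" using cW by (auto simp: mat_diag_def)
    have "(W * ?D l) $$ (i, j) = (?D m * W) $$ (i, j)" using e by simp
    then have "W $$ (i, j) * complex_of_real (l j) = complex_of_real (m i) * W $$ (i, j)"
      unfolding mat_diag_mult_right[OF cW] mat_diag_mult_left[OF cW] using ij by simp
    then have "W $$ (i, j) = 0 \<or> l j = m i" by auto
    then show "(W * ?D (\<lambda>i. f (l i))) $$ (i, j) = (?D (\<lambda>i. f (m i)) * W) $$ (i, j)"
      unfolding mat_diag_mult_right[OF cW] mat_diag_mult_left[OF cW] using ij by auto
  qed (use cW in \<open>auto simp: mat_diag_def\<close>)
  have "U * ?D (\<lambda>i. f (l i)) * mat_adjoint U = V * (W * ?D (\<lambda>i. f (l i))) * mat_adjoint U"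
    by (subst (1) VW[symmetric]) (use cU cV cW cD in \<open>simp add: assoc\<close>)
  also have "\<dots> = V * ?D (\<lambda>i. f (m i)) * (W * mat_adjoint U)"
    unfolding f using cU cV cW cD by (simp add: assoc)
  finally show ?thesis unfolding WU .
qed

definition mat_fun :: "(real \<Rightarrow> real) \<Rightarrow> complex mat \<Rightarrow> complex mat" where
  "mat_fun f A = (THE B. \<exists>U l. spectral_form A U l \<and>
     B = U * mat_diag (dim_row A) (\<lambda>i. complex_of_real (f (l i))) * mat_adjoint U)"

definition mat_abs :: "complex mat \<Rightarrow> complex mat" where
  "mat_abs A = mat_fun sqrt (mat_adjoint A * A)"

definition schatten_norm :: "real \<Rightarrow> complex mat \<Rightarrow> real" where
  "schatten_norm p A = (Re (mtrace (mat_fun (\<lambda>x. x powr p) (mat_abs A)))) powr (1 / p)"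

definition max_output_norm :: "real \<Rightarrow> nat \<Rightarrow> (complex mat \<Rightarrow> complex mat) \<Rightarrow> real" where
  "max_output_norm p d \<Phi> = (SUP \<rho> \<in> density_ops d. schatten_norm p (\<Phi> \<rho>))"

text \<open>The sum \<open>(1/n) \<Sum>\<^sub>i V\<^sub>i \<rho> V\<^sub>i\<^sup>\<dagger>\<close>, written entrywise, with \<open>i\<close> ranging over \<open>0, \<dots>, n - 1\<close>.\<close>

definition random_unitary_map ::
    "nat \<Rightarrow> nat \<Rightarrow> (nat \<Rightarrow> complex mat) \<Rightarrow> complex mat \<Rightarrow> complex mat" where
  "random_unitary_map d n V \<rho> =
     mat d d (\<lambda>rs. (1 / of_nat n) * (\<Sum>i<n. (V i * \<rho> * mat_adjoint (V i)) $$ rs))"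

definition randomizing :: "real \<Rightarrow> nat \<Rightarrow> (complex mat \<Rightarrow> complex mat) \<Rightarrow> bool" where
  "randomizing \<epsilon> d \<Phi> \<longleftrightarrow>
     (\<forall>\<rho>\<in>density_ops d. op_norm (\<Phi> \<rho> - (1 / of_nat d) \<cdot>\<^sub>m 1\<^sub>m d) \<le> \<epsilon> / real d)"

definition kron :: "complex mat \<Rightarrow> complex mat \<Rightarrow> complex mat" where
  "kron A B = mat (dim_row A * dim_row B) (dim_col A * dim_col B)
     (\<lambda>(r, s). A $$ (r div dim_row B, s div dim_col B) * B $$ (r mod dim_row B, s mod dim_col B))"

definition unit_mat :: "nat \<Rightarrow> nat \<Rightarrow> nat \<Rightarrow> complex mat" where
  "unit_mat d i j = mat d d (\<lambda>rs. if rs = (i, j) then 1 else 0)"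

text \<open>
  For linear maps \<open>\<Phi>\<close> on operators of \<open>\<complex>\<^sup>d\<close> and \<open>\<Psi>\<close> on operators of \<open>\<complex>\<^sup>e\<close>, the linear map
  \<open>\<Phi> \<otimes> \<Psi>\<close> is given by expanding the argument in the basis \<open>E\<^sub>i\<^sub>j \<otimes> E\<^sub>k\<^sub>l\<close> of matrix units.
\<close>

definition tensor_map :: "nat \<Rightarrow> nat \<Rightarrow> (complex mat \<Rightarrow> complex mat) \<Rightarrow>
    (complex mat \<Rightarrow> complex mat) \<Rightarrow> complex mat \<Rightarrow> complex mat" where
  "tensor_map d e \<Phi> \<Psi> X = mat (d * e) (d * e) (\<lambda>rs.
     \<Sum>i<d. \<Sum>j<d. \<Sum>k<e. \<Sum>l<e.
       X $$ (i * e + k, j * e + l) * kron (\<Phi> (unit_mat d i j)) (\<Psi> (unit_mat e k l)) $$ rs)"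

lemma tensor_map_kron:
  assumes A: "A \<in> carrier_mat d d" and B: "B \<in> carrier_mat e e"
    and \<Phi>: "\<And>X. \<Phi> X \<in> carrier_mat d d" and \<Psi>: "\<And>Y. \<Psi> Y \<in> carrier_mat e e"
    and lin\<Phi>: "\<And>X rs. X \<in> carrier_mat d d \<Longrightarrow> rs \<in> {..<d} \<times> {..<d} \<Longrightarrow>
      \<Phi> X $$ rs = (\<Sum>i<d. \<Sum>j<d. X $$ (i, j) * \<Phi> (unit_mat d i j) $$ rs)"
    and lin\<Psi>: "\<And>Y rs. Y \<in> carrier_mat e e \<Longrightarrow> rs \<in> {..<e} \<times> {..<e} \<Longrightarrow>
      \<Psi> Y $$ rs = (\<Sum>k<e. \<Sum>l<e. Y $$ (k, l) * \<Psi> (unit_mat e k l) $$ rs)"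
  shows "tensor_map d e \<Phi> \<Psi> (kron A B) = kron (\<Phi> A) (\<Psi> B)"
proof (rule eq_matI)
  have d\<Phi>: "dim_row (\<Phi> X) = d" "dim_col (\<Phi> X) = d" for X using \<Phi>[of X] by auto
  have d\<Psi>: "dim_row (\<Psi> X) = e" "dim_col (\<Psi> X) = e" for X using \<Psi>[of X] by auto
  have dA: "dim_row A = d" "dim_col A = d" "dim_row B = e" "dim_col B = e" using A B by auto
  fix r s assume "r < dim_row (kron (\<Phi> A) (\<Psi> B))" "s < dim_col (kron (\<Phi> A) (\<Psi> B))"
  then have rs: "r < d * e" "s < d * e" by (auto simp: kron_def d\<Phi> d\<Psi>)
  then have e: "0 < e" by (cases e) auto
  have q: "r div e < d" "s div e < d" "r mod e < e" "s mod e < e"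
    using rs e by (auto simp: less_mult_imp_div_less)
  have idx: "i * e + k < d * e" if "i < d" "k < e" for i k
  proof -
    have "i * e + k < Suc i * e" using that by simp
    also have "\<dots> \<le> d * e" using that by (intro mult_le_mono1) simp
    finally show ?thesis .
  qed
  have "tensor_map d e \<Phi> \<Psi> (kron A B) $$ (r, s) =
    (\<Sum>i<d. \<Sum>j<d. \<Sum>k<e. \<Sum>l<e. (A $$ (i, j) * B $$ (k, l)) *
      (\<Phi> (unit_mat d i j) $$ (r div e, s div e) * \<Psi> (unit_mat e k l) $$ (r mod e, s mod e)))"
    using rs e by (auto simp: tensor_map_def kron_def d\<Phi> d\<Psi> dA idx intro!: sum.cong)
  also have "\<dots> = (\<Sum>i<d. \<Sum>j<d. A $$ (i, j) * \<Phi> (unit_mat d i j) $$ (r div e, s div e)) *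
      (\<Sum>k<e. \<Sum>l<e. B $$ (k, l) * \<Psi> (unit_mat e k l) $$ (r mod e, s mod e))"
  proof -
    have 1: "(\<Sum>i<d. \<Sum>j<d. x i j) * S = (\<Sum>i<d. \<Sum>j<d. x i j * S)" for x and S :: complex
      by (simp add: sum_distrib_right)
    have 2: "c * (\<Sum>k<e. \<Sum>l<e. y k l) = (\<Sum>k<e. \<Sum>l<e. c * y k l)" for y and c :: complex
      by (simp add: sum_distrib_left)
    show ?thesis unfolding 1 unfolding 2 by (simp only: mult_ac)
  qed
  also have "\<dots> = kron (\<Phi> A) (\<Psi> B) $$ (r, s)"
    using rs q lin\<Phi>[OF A, of "(r div e, s div e)"] lin\<Psi>[OF B, of "(r mod e, s mod e)"]
    by (simp add: kron_def d\<Phi> d\<Psi>)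
  finally show "tensor_map d e \<Phi> \<Psi> (kron A B) $$ (r, s) = kron (\<Phi> A) (\<Psi> B) $$ (r, s)" .
qed (use carrier_matD[OF \<Phi>[of A]] carrier_matD[OF \<Psi>[of B]]
      in \<open>auto simp: tensor_map_def kron_def\<close>)

definition num_unitaries :: "real \<Rightarrow> nat \<Rightarrow> nat" where
  "num_unitaries \<epsilon> d = nat \<lceil>134 * real d * ln (real d) / \<epsilon>\<^sup>2\<rceil>"

end

(*
  An output state of an epsilon-randomizing channel has trace 1 and all eigenvalues at most
  (1 + epsilon)/d, so the sum of their p-th powers is at most ((1 + epsilon)/d)^(p - 1); complex
  conjugation does not change spectra, so the conjugate channel obeys the same bound.
  On the other hand V (x) cnj V fixes the maximally entangled state, so n of the n^2 unitaries of
  the product channel fix it and the output has overlap at least 1/n with it.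
  Since n grows like d ln d and 2 - 2/p > 1, the first bound is eventually below the second.
*)

theory Submission
  imports Defs "Jordan_Normal_Form.Spectral_Radius" "HOL-Real_Asymp.Real_Asymp"
begin

section \<open>Adjoints and unitary matrices\<close>

text \<open>The Schatten norm rests on a definite description over diagonalisations, so nothing can
  be evaluated before Hermitian matrices are shown to have one; after that,
  \<open>spectral_form_schatten_norm\<close> turns every norm into a sum over eigenvalues. Taking
  the p-th root gives each channel the exponent 1 - 1/p, and the two channels together give 2 - 2/p.
  This exceeds 1 exactly for p > 2, while n exceeds linear growth in d only by a logarithm: that is
  where the threshold on p comes from. An overlap is a weighted mean of eigenvalues, so some
  eigenvalue, and with it every p-norm, is at least as large. \<open>tensor_map\<close> is an
  expansion in matrix units and shows no unitaries. It is rewritten as a random unitary channel with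
  unitaries V_x (x) cnj V_y, so that the facts about a single channel apply again in dimension d *
  d. A supremum of reals carries information only for nonempty bounded sets, hence the auxiliary
  bounds and the nonemptiness of \<open>density_ops\<close>. The factor 134 stems from the
  probabilistic construction of randomizing channels, whose existence is assumed here.\<close>

lemma mat_adjoint_index [simp]:
  "dim_row (mat_adjoint A) = dim_col A" "dim_col (mat_adjoint A) = dim_row A"
  "i < dim_col A \<Longrightarrow> j < dim_row A \<Longrightarrow> mat_adjoint A $$ (i, j) = conjugate (A $$ (j, i))"
  by (auto simp: mat_adjoint_def mat_of_rows_def)

lemma mat_adjoint_carrier [simp]:
  "A \<in> carrier_mat n m \<Longrightarrow> mat_adjoint A \<in> carrier_mat m n"
  by auto

lemma mat_adjoint_adjoint [simp]: "mat_adjoint (mat_adjoint A) = A"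
  by (rule eq_matI) auto

text \<open>Entries as sums over \<open>{..<m}\<close> instead of scalar products of rows and
  columns, so that sums can be swapped and reindexed. Later proofs delete
  \<open>index_mult_mat(1)\<close> from the simpset to keep this form.\<close>

lemma mult_mat_index:
  "A \<in> carrier_mat n m \<Longrightarrow> B \<in> carrier_mat m k \<Longrightarrow> i < n \<Longrightarrow> j < k \<Longrightarrow>
    (A * B) $$ (i, j) = (\<Sum>l<m. A $$ (i, l) * B $$ (l, j))"
  by (auto simp: scalar_prod_def atLeast0LessThan)

lemma mult_mat_vec_index:
  "A \<in> carrier_mat n m \<Longrightarrow> v \<in> carrier_vec m \<Longrightarrow> i < n \<Longrightarrow>
    (A *\<^sub>v v) $ i = (\<Sum>l<m. A $$ (i, l) * v $ l)"
  by (auto simp: scalar_prod_def atLeast0LessThan)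

lemma cscalar_prod_sum:
  "w \<in> carrier_vec n \<Longrightarrow> v \<bullet>c w = (\<Sum>i<n. v $ i * conjugate (w $ i))"
  by (auto simp: scalar_prod_def atLeast0LessThan)

lemma mat_adjoint_mult:
  fixes A B :: "complex mat"
  assumes A: "A \<in> carrier_mat n m" and B: "B \<in> carrier_mat m k"
  shows "mat_adjoint (A * B) = mat_adjoint B * mat_adjoint A"
proof (rule eq_matI)
  fix i j assume "i < dim_row (mat_adjoint B * mat_adjoint A)" "j < dim_col (mat_adjoint B * mat_adjoint A)"
  then have ij: "i < k" "j < n" using A B by auto
  show "mat_adjoint (A * B) $$ (i, j) = (mat_adjoint B * mat_adjoint A) $$ (i, j)"
    using A B ij
    by (subst mult_mat_index[of _ k m _ n]) (auto simp: mult_mat_index[OF A B] mult.commute intro!: sum.cong simp del: index_mult_mat(1))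
qed (use A B in auto)

lemma cscalar_prod_mat_adjoint:
  fixes A :: "complex mat"
  assumes A: "A \<in> carrier_mat n m" and v: "v \<in> carrier_vec m" and w: "w \<in> carrier_vec n"
  shows "(A *\<^sub>v v) \<bullet>c w = v \<bullet>c (mat_adjoint A *\<^sub>v w)"
proof -
  have "(A *\<^sub>v v) \<bullet>c w = (\<Sum>i<n. \<Sum>j<m. A $$ (i, j) * v $ j * cnj (w $ i))"
    by (simp add: cscalar_prod_sum[OF w] mult_mat_vec_index[OF A v] sum_distrib_right)
  also have "\<dots> = (\<Sum>j<m. \<Sum>i<n. A $$ (i, j) * v $ j * cnj (w $ i))"
    by (rule sum.swap)
  also have "\<dots> = (\<Sum>j<m. v $ j * cnj ((mat_adjoint A *\<^sub>v w) $ j))"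
  proof (rule sum.cong[OF refl])
    fix j assume "j \<in> {..<m}"
    then have j: "j < m" by simp
    have "(mat_adjoint A *\<^sub>v w) $ j = (\<Sum>i<n. mat_adjoint A $$ (j, i) * w $ i)"
      using A w j by (intro mult_mat_vec_index) auto
    then show "(\<Sum>i<n. A $$ (i, j) * v $ j * cnj (w $ i)) = v $ j * cnj ((mat_adjoint A *\<^sub>v w) $ j)"
      using A j by (auto simp: sum_distrib_left intro!: sum.cong)
  qed
  also have "\<dots> = v \<bullet>c (mat_adjoint A *\<^sub>v w)"
    using cscalar_prod_sum[OF mult_mat_vec_carrier[OF mat_adjoint_carrier[OF A] w], of v] by simp
  finally show ?thesis .
qed

lemma l2_norm_square: "complex_of_real ((l2_norm v)\<^sup>2) = v \<bullet>c v"
proof -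
  have "v \<bullet>c v = (\<Sum>i<dim_vec v. v $ i * cnj (v $ i))"
    using cscalar_prod_sum[of v "dim_vec v" v] by simp
  also have "\<dots> = (\<Sum>i<dim_vec v. complex_of_real ((cmod (v $ i))\<^sup>2))"
    by (intro sum.cong refl) (simp only: complex_norm_square)
  finally show ?thesis by (simp add: l2_norm_def sum_nonneg)
qed

text \<open>A one-sided inverse of a square matrix is two-sided.\<close>

lemma unitary_matI:
  assumes "U \<in> carrier_mat d d" "mat_adjoint U * U = 1\<^sub>m d"
  shows "unitary_mat d U"
  using assms mat_mult_left_right_inverse[of "mat_adjoint U" d U] by (auto simp: unitary_mat_def)

lemma unitary_matD:
  assumes "unitary_mat d U"
  shows "U \<in> carrier_mat d d" "U * mat_adjoint U = 1\<^sub>m d" "mat_adjoint U * U = 1\<^sub>m d"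
  using assms by (auto simp: unitary_mat_def)

lemma unitary_mat_adjoint: "unitary_mat d U \<Longrightarrow> unitary_mat d (mat_adjoint U)"
  by (auto simp: unitary_mat_def)

lemma unitary_mat_mult:
  assumes U: "unitary_mat d U" and V: "unitary_mat d V"
  shows "unitary_mat d (U * V)"
proof (rule unitary_matI)
  note c = unitary_matD[OF U] unitary_matD[OF V]
  have "mat_adjoint (U * V) * (U * V) = mat_adjoint V * (mat_adjoint U * (U * V))"
    using c by (simp add: mat_adjoint_mult[of _ d d _ d] assoc_mult_mat[of _ d d _ d _ d])
  also have "mat_adjoint U * (U * V) = mat_adjoint U * U * V"
    using c by (intro assoc_mult_mat[symmetric]) auto
  also have "mat_adjoint V * (mat_adjoint U * U * V) = 1\<^sub>m d"
    using c by simp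
  finally show "mat_adjoint (U * V) * (U * V) = 1\<^sub>m d" .
qed (use unitary_matD[OF U] unitary_matD[OF V] in auto)

lemma unitary_mat_l2_norm:
  assumes U: "unitary_mat d U" and v: "v \<in> carrier_vec d"
  shows "l2_norm (U *\<^sub>v v) = l2_norm v"
proof -
  note c = unitary_matD[OF U]
  have "(U *\<^sub>v v) \<bullet>c (U *\<^sub>v v) = v \<bullet>c (mat_adjoint U *\<^sub>v (U *\<^sub>v v))"
    using c v by (intro cscalar_prod_mat_adjoint) auto
  also have "mat_adjoint U *\<^sub>v (U *\<^sub>v v) = (mat_adjoint U * U) *\<^sub>v v"
    using c v by (intro assoc_mult_mat_vec[symmetric]) auto
  also have "\<dots> = v" using c v by simp
  finally have "(l2_norm (U *\<^sub>v v))\<^sup>2 = (l2_norm v)\<^sup>2"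
    unfolding l2_norm_square[symmetric] of_real_eq_iff .
  then show ?thesis by (simp add: l2_norm_def sum_nonneg)
qed

lemma mat_diag_sandwich_index:
  fixes U V :: "complex mat"
  assumes U: "U \<in> carrier_mat d d" and ij: "i < d" "j < d"
  shows "(U * mat_diag d f * mat_adjoint U) $$ (i, j) = (\<Sum>k<d. U $$ (i, k) * f k * cnj (U $$ (j, k)))"
  using assms by (subst mult_mat_index[of _ d d _ d]) (auto simp: mat_diag_mult_right[OF U] intro!: sum.cong)

text \<open>Gram--Schmidt keeps the first vector, so normalising the columns afterwards leaves \<open>v\<close> in place.\<close>

lemma unitary_completion:
  assumes v: "v \<in> carrier_vec d" and v1: "v \<bullet>c v = 1"
  shows "\<exists>W. unitary_mat d W \<and> col W 0 = v"
proof -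
  have v0: "v \<noteq> 0\<^sub>v d" using v v1 by auto
  then have d: "0 < d" using v by (cases d) auto
  interpret cof_vec_space d "TYPE(complex)" .
  define b where "b = basis_completion v"
  define ws where "ws = gram_schmidt d b"
  note bc = basis_completion[OF v v0, folded b_def]
  obtain vs where "b = v # vs" using bc d by (cases b) auto
  then have hd: "hd ws = v" unfolding ws_def using v by simp
  note gs = gram_schmidt_result[OF bc(2) bc(4) bc(5) ws_def]
  have len: "length ws = d" using gs bc by simp
  then have ws0: "ws ! 0 = v" using hd d by (metis hd_conv_nth list.size(3) less_irrefl)
  have wc: "ws ! i \<in> carrier_vec d" if "i < d" for i using gs(3) len that by auto
  have orth: "ws ! i \<bullet>c ws ! j = 0 \<longleftrightarrow> i \<noteq> j" if "i < d" "j < d" for i j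
    using corthogonalD[OF gs(2)] len that by auto
  define W where "W = mat d d (\<lambda>(i, j). (ws ! j) $ i / complex_of_real (l2_norm (ws ! j)))"
  have W: "W \<in> carrier_mat d d" unfolding W_def by simp
  have "mat_adjoint W * W = 1\<^sub>m d"
  proof (rule eq_matI)
    fix i j assume "i < dim_row (1\<^sub>m d :: complex mat)" "j < dim_col (1\<^sub>m d :: complex mat)"
    then have ij: "i < d" "j < d" by auto
    have "(mat_adjoint W * W) $$ (i, j) = (\<Sum>k<d. cnj (W $$ (k, i)) * W $$ (k, j))"
      using W ij by (subst mult_mat_index[of _ d d _ d]) auto
    also have "\<dots> = (\<Sum>k<d. (ws ! j) $ k * cnj ((ws ! i) $ k)) /
        complex_of_real (l2_norm (ws ! i) * l2_norm (ws ! j))"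
      using ij by (auto simp: W_def sum_divide_distrib mult_ac intro!: sum.cong)
    also have "(\<Sum>k<d. (ws ! j) $ k * cnj ((ws ! i) $ k)) = ws ! j \<bullet>c ws ! i"
      using cscalar_prod_sum[OF wc[OF ij(1)], of "ws ! j"] by simp
    \<comment> \<open>At \<open>i = j\<close>, \<open>orth\<close> also says that no basis vector is
      zero, so the division by its squared norm is legitimate.\<close>
    also have "(ws ! j \<bullet>c ws ! i) / complex_of_real (l2_norm (ws ! i) * l2_norm (ws ! j)) = (if i = j then 1 else 0)"
      using orth ij l2_norm_square[of "ws ! i"]
      by (auto simp: power2_eq_square)
    finally show "(mat_adjoint W * W) $$ (i, j) = 1\<^sub>m d $$ (i, j)" using ij by simp
  qed (use W in auto)
  then have "unitary_mat d W" using W by (rule unitary_matI[rotated])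
  moreover have "col W 0 = v"
  proof -
    have "complex_of_real ((l2_norm v)\<^sup>2) = 1" using l2_norm_square[of v] v1 by simp
    then have "(l2_norm v)\<^sup>2 = 1" using of_real_eq_1_iff by blast
    then have "l2_norm v = 1" by (simp add: l2_norm_def sum_nonneg)
    then show ?thesis using v d by (intro eq_vecI) (auto simp: W_def ws0)
  qed
  ultimately show ?thesis by blast
qed

section \<open>The spectral theorem and Schatten norms\<close>

lemma spectral_formI:
  assumes "A \<in> carrier_mat d d" "unitary_mat d U"
    and "A = U * mat_diag d (\<lambda>i. complex_of_real (l i)) * mat_adjoint U"
  shows "spectral_form A U l"
  using assms(2,3) carrier_matD(1)[OF assms(1)] by (simp only: spectral_form_def)

lemma spectral_formD:
  assumes "spectral_form A U l" "A \<in> carrier_mat d d"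
  shows "unitary_mat d U" "A = U * mat_diag d (\<lambda>i. complex_of_real (l i)) * mat_adjoint U"
  using assms by (auto simp: spectral_form_def)

text \<open>Deflation: a unit eigenvector is completed to a unitary \<open>W\<close>, conjugation by
  \<open>W\<close> splits off a real 1 by 1 block, and the induction hypothesis diagonalises the
  remaining Hermitian block \<open>C\<close>.\<close>

lemma hermitian_spectral_form:
  assumes "A \<in> carrier_mat n n" "mat_adjoint A = A"
  shows "\<exists>U l. spectral_form A U l"
  using assms
proof (induction n arbitrary: A)
  case 0
  then have "spectral_form A (1\<^sub>m 0) (\<lambda>_. 0)"
    by (auto simp: spectral_form_def unitary_mat_def intro!: eq_matI)
  then show ?case by blast
next
  case (Suc n A)
  note A = Suc.prems(1)
  let ?d = "Suc n"
  obtain e w where ev: "eigenvector A w e"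
    using spectrum_non_empty[OF A] by (auto simp: spectrum_def eigenvalue_def)
  then have w: "w \<in> carrier_vec ?d" "w \<noteq> 0\<^sub>v ?d" "A *\<^sub>v w = e \<cdot>\<^sub>v w"
    using A by (auto simp: eigenvector_def)
  define c where "c = complex_of_real (1 / l2_norm w)"
  define v where "v = c \<cdot>\<^sub>v w"
  have v: "v \<in> carrier_vec ?d" using w by (simp add: v_def)
  have "w \<bullet>c w \<noteq> 0" using w by simp
  then have "l2_norm w \<noteq> 0" using l2_norm_square[of w] by auto
  moreover have "v \<bullet>c v = c * (cnj c * (w \<bullet>c w))"
    using w by (simp add: v_def conjugate_smult_vec)
  ultimately have v1: "v \<bullet>c v = 1"
    using l2_norm_square[of w, symmetric] by (simp add: c_def power2_eq_square)
  have Av: "A *\<^sub>v v = e \<cdot>\<^sub>v v"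
    using w A by (simp add: v_def mult_mat_vec smult_smult_assoc mult.commute)
  obtain W where W: "unitary_mat ?d W" and W0: "col W 0 = v"
    using unitary_completion[OF v v1] by blast
  note Wc = unitary_matD[OF W]
  define B where "B = mat_adjoint W * A * W"
  have B: "B \<in> carrier_mat ?d ?d" using A Wc by (auto simp: B_def)
  note assoc = assoc_mult_mat[of _ ?d ?d _ ?d _ ?d] mult_carrier_mat[of _ ?d ?d _ ?d]
  have Bh: "mat_adjoint B = B"
    using A Wc Suc.prems(2) by (simp add: B_def mat_adjoint_mult[of _ ?d ?d _ ?d] assoc)
  have B_sym: "B $$ (i, j) = cnj (B $$ (j, i))" if "i < ?d" "j < ?d" for i j
    using that B mat_adjoint_index(3)[of i B j] by (simp add: Bh)
  have AWB: "A = W * B * mat_adjoint W"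
  proof -
    have "W * B * mat_adjoint W = (W * mat_adjoint W) * (A * (W * mat_adjoint W))"
      unfolding B_def using A Wc(1) by (simp add: assoc)
    then show ?thesis using Wc A by simp
  qed
  \<comment> \<open>Column 0 of \<open>W\<close> is the eigenvector \<open>v\<close>, so column 0 of
    \<open>B\<close> is \<open>e\<close> times \<open>mat_adjoint W\<close> applied to that column;
    orthonormality leaves \<open>e\<close> times the first unit vector. Hermitian symmetry carries
    this over to row 0 and makes \<open>e\<close> real.\<close>
  have col0: "B $$ (i, 0) = (if i = 0 then e else 0)" if i: "i < ?d" for i
  proof -
    have "col B 0 = mat_adjoint W *\<^sub>v (A *\<^sub>v col W 0)"
    proof -
      have "B = mat_adjoint W * (A * W)"
        unfolding B_def using A Wc(1) by (intro assoc(1)) auto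
      then show ?thesis
        using col_mult2[OF mat_adjoint_carrier[OF Wc(1)] mult_carrier_mat[OF A Wc(1)], of 0]
          col_mult2[OF A Wc(1), of 0]
        by (simp only: zero_less_Suc)
    qed
    also have "\<dots> = e \<cdot>\<^sub>v (mat_adjoint W *\<^sub>v col W 0)"
      using Av Wc(1) v by (simp add: W0 mult_mat_vec[of _ ?d ?d])
    also have "mat_adjoint W *\<^sub>v col W 0 = col (mat_adjoint W * W) 0"
      using Wc(1) by (simp add: col_mult2[of _ ?d ?d _ ?d])
    finally have "col B 0 $ i = e * (col (1\<^sub>m ?d) 0 $ i)"
      using i by (simp add: Wc(3))
    then show ?thesis using B i by auto
  qed
  have row0: "B $$ (0, i) = (if i = 0 then e else 0)" if i: "i < ?d" for i
    using B_sym[of 0 i] col0[OF i] B_sym[of 0 0] col0[of 0] i by auto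
  have e: "e = complex_of_real (Re e)"
    using B_sym[of 0 0] col0[of 0] by (auto simp: complex_eq_iff)
  define C where "C = mat n n (\<lambda>(i, j). B $$ (Suc i, Suc j))"
  have C: "C \<in> carrier_mat n n" by (simp add: C_def)
  have "mat_adjoint C = C"
    by (rule eq_matI) (auto simp: C_def B_sym[symmetric])
  then obtain U l where "spectral_form C U l" using Suc.IH[OF C] by blast
  then have U: "unitary_mat n U"
    and CU: "C = U * mat_diag n (\<lambda>i. complex_of_real (l i)) * mat_adjoint U"
    using C by (auto simp: spectral_form_def)
  note Uc = unitary_matD[OF U]
  \<comment> \<open>\<open>X\<close> is the block sum of 1 and \<open>U\<close>, and
    \<open>m\<close> puts the split-off eigenvalue in front of those of \<open>C\<close>.\<close>
  define X where "X = mat ?d ?d (\<lambda>(i, j). case (i, j) of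
    (0, 0) \<Rightarrow> 1 | (Suc i', Suc j') \<Rightarrow> U $$ (i', j') | _ \<Rightarrow> 0)"
  define m where "m = (\<lambda>i. case i of 0 \<Rightarrow> Re e | Suc i' \<Rightarrow> l i')"
  have X: "X \<in> carrier_mat ?d ?d" by (simp add: X_def)
  have X_index: "X $$ (0, 0) = 1" "X $$ (Suc i, 0) = 0" "X $$ (0, Suc j) = 0"
    "X $$ (Suc i, Suc j) = U $$ (i, j)" if "i < n" "j < n" for i j
    using that by (auto simp: X_def)
  have X_index': "X $$ (0, 0) = 1" by (simp add: X_def)
  have "mat_adjoint X * X = 1\<^sub>m ?d"
  proof (rule eq_matI)
    fix i j assume "i < dim_row (1\<^sub>m ?d :: complex mat)" "j < dim_col (1\<^sub>m ?d :: complex mat)"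
    then have ij: "i < ?d" "j < ?d" by auto
    have "(mat_adjoint X * X) $$ (i, j) = (\<Sum>k<?d. cnj (X $$ (k, i)) * X $$ (k, j))"
      using X ij by (subst mult_mat_index[of _ ?d ?d _ ?d]) auto
    also have "\<dots> = cnj (X $$ (0, i)) * X $$ (0, j) + (\<Sum>k<n. cnj (X $$ (Suc k, i)) * X $$ (Suc k, j))"
      by (rule sum.lessThan_Suc_shift)
    also have "\<dots> = (if i = j then 1 else 0)"
    proof (cases i; cases j)
      fix i' j' assume [simp]: "i = Suc i'" "j = Suc j'"
      have "(mat_adjoint U * U) $$ (i', j') = (\<Sum>k<n. cnj (U $$ (k, i')) * U $$ (k, j'))"
        using Uc(1) ij by (subst mult_mat_index[of _ n n _ n]) auto
      then show ?thesis using ij by (simp add: X_index Uc(3))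
    qed (use ij in \<open>auto simp: X_index X_index'\<close>)
    finally show "(mat_adjoint X * X) $$ (i, j) = 1\<^sub>m ?d $$ (i, j)" using ij by simp
  qed (use X in auto)
  then have Xu: "unitary_mat ?d X" using X by (rule unitary_matI[rotated])
  let ?M = "mat_diag ?d (\<lambda>i. complex_of_real (m i))"
  have BX: "B = X * ?M * mat_adjoint X"
  proof (rule eq_matI)
    fix i j assume "i < dim_row (X * ?M * mat_adjoint X)" "j < dim_col (X * ?M * mat_adjoint X)"
    then have ij: "i < ?d" "j < ?d" using X by auto
    have "(X * ?M * mat_adjoint X) $$ (i, j) = (\<Sum>k<?d. X $$ (i, k) * complex_of_real (m k) * cnj (X $$ (j, k)))"
      by (rule mat_diag_sandwich_index[OF X ij])
    also have "\<dots> = X $$ (i, 0) * complex_of_real (m 0) * cnj (X $$ (j, 0))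
        + (\<Sum>k<n. X $$ (i, Suc k) * complex_of_real (m (Suc k)) * cnj (X $$ (j, Suc k)))"
      by (rule sum.lessThan_Suc_shift)
    also have "\<dots> = B $$ (i, j)"
    proof (cases i; cases j)
      fix i' j' assume [simp]: "i = Suc i'" "j = Suc j'"
      have "B $$ (i, j) = C $$ (i', j')" using ij by (simp add: C_def)
      also have "\<dots> = (\<Sum>k<n. U $$ (i', k) * complex_of_real (l k) * cnj (U $$ (j', k)))"
        using ij by (subst CU) (intro mat_diag_sandwich_index[OF Uc(1)], auto)
      finally show ?thesis using ij by (simp add: X_index m_def)
    qed (use ij e in \<open>auto simp: X_index X_index' col0 row0 m_def\<close>)
    finally show "B $$ (i, j) = (X * ?M * mat_adjoint X) $$ (i, j)" ..
  qed (use X B in auto)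
  have M: "?M \<in> carrier_mat ?d ?d" by simp
  have "A = W * X * ?M * mat_adjoint (W * X)"
    using X Wc(1) M by (subst AWB, subst BX) (simp add: mat_adjoint_mult[of _ ?d ?d _ ?d] assoc)
  then have "spectral_form A (W * X) m"
    by (rule spectral_formI[OF A unitary_mat_mult[OF W Xu]])
  then show ?case by blast
qed

text \<open>Polarisation: the order on complex numbers forces the quadratic form to be real, and its
  values at \<open>unit_vec d i + c \<cdot>\<^sub>v unit_vec d j\<close> for two choices of
  \<open>c\<close> determine how entries (i, j) and (j, i) are related.\<close>

lemma psd_mat_hermitian:
  assumes "psd_mat d A"
  shows "mat_adjoint A = A"
proof (rule eq_matI)
  have A: "A \<in> carrier_mat d d" and pos: "\<And>v. v \<in> carrier_vec d \<Longrightarrow> 0 \<le> (A *\<^sub>v v) \<bullet>c v"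
    using assms by (auto simp: psd_mat_def)
  fix i j assume "i < dim_row A" "j < dim_col A"
  then have ij: "i < d" "j < d" using A by auto
  define q where "q c = (A *\<^sub>v (unit_vec d i + c \<cdot>\<^sub>v unit_vec d j)) \<bullet>c (unit_vec d i + c \<cdot>\<^sub>v unit_vec d j)" for c
  have q_real: "Im (q c) = 0" for c
    using pos[of "unit_vec d i + c \<cdot>\<^sub>v unit_vec d j"] by (simp add: q_def less_eq_complex_def)
  have unit: "w \<bullet>c unit_vec d k = w $ k" if "w \<in> carrier_vec d" "k < d" for w :: "complex vec" and k
    using that by (subst cscalar_prod_sum[of _ d]) (auto simp: unit_vec_def if_distrib cong: if_cong)
  have col: "A *\<^sub>v unit_vec d k = col A k" if "k < d" for k
    using that A by (intro eq_vecI) (auto simp: mult_mat_vec_def)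
  have q: "q c = A $$ (i, i) + c * A $$ (i, j) + cnj c * (A $$ (j, i) + c * A $$ (j, j))" for c
  proof -
    have v: "A *\<^sub>v (unit_vec d i + c \<cdot>\<^sub>v unit_vec d j) = col A i + c \<cdot>\<^sub>v col A j"
      using A ij by (simp add: mult_add_distrib_mat_vec[of _ d d] mult_mat_vec[of _ d d] col)
    have x: "col A i + c \<cdot>\<^sub>v col A j \<in> carrier_vec d" using A by auto
    have "q c = (col A i + c \<cdot>\<^sub>v col A j) \<bullet>c unit_vec d i + cnj c * ((col A i + c \<cdot>\<^sub>v col A j) \<bullet>c unit_vec d j)"
      unfolding q_def v using x by (simp add: conjugate_add_vec[of _ d] conjugate_smult_vec scalar_prod_add_distrib[of _ d])
    then show ?thesis using x A ij by (simp add: unit)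
  qed
  have d0: "Im (A $$ (k, k)) = 0" if k: "k < d" for k
  proof -
    have "Im ((A *\<^sub>v unit_vec d k) \<bullet>c unit_vec d k) = 0"
      using pos[of "unit_vec d k"] by (simp add: less_eq_complex_def)
    then show ?thesis using A k by (simp add: col unit)
  qed
  \<comment> \<open>\<open>c = 1\<close> makes A_ij + A_ji real; \<open>c = \<i>\<close> makes \<i>
    * (A_ij - A_ji) real, which compares the real parts.\<close>
  have "Im (A $$ (i, j)) = - Im (A $$ (j, i))"
    using q_real[of 1] d0[OF ij(1)] d0[OF ij(2)] by (simp add: q)
  moreover have "Re (A $$ (i, j)) = Re (A $$ (j, i))"
    using q_real[of \<i>] d0[OF ij(1)] d0[OF ij(2)] by (simp add: q)
  ultimately show "mat_adjoint A $$ (i, j) = A $$ (i, j)"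
    using A ij by (simp add: complex_eq_iff)
qed (use assms in \<open>auto simp: psd_mat_def\<close>)

lemma psd_mat_spectral_form: "psd_mat d A \<Longrightarrow> \<exists>U l. spectral_form A U l"
  using hermitian_spectral_form psd_mat_hermitian by (auto simp: psd_mat_def)

text \<open>\<open>spectral_unique\<close> lets the definite description be evaluated at whichever
  diagonalisation is at hand.\<close>

lemma mat_fun_spectral_form:
  assumes "spectral_form A U l"
  shows "mat_fun f A = U * mat_diag (dim_row A) (\<lambda>i. complex_of_real (f (l i))) * mat_adjoint U"
  unfolding mat_fun_def
  using assms by (intro the_equality) (auto intro: spectral_unique)

text \<open>The diagonalising unitary is kept, so the functional calculus can be iterated: square
  root first, p-th power afterwards.\<close>

lemma spectral_form_mat_fun:
  assumes A: "A \<in> carrier_mat d d" and "spectral_form A U l"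
  shows "spectral_form (mat_fun f A) U (\<lambda>i. f (l i))" "mat_fun f A \<in> carrier_mat d d"
proof -
  have U: "unitary_mat d U" using assms by (auto simp: spectral_form_def)
  note Uc = unitary_matD[OF U]
  have eq: "mat_fun f A = U * mat_diag d (\<lambda>i. complex_of_real (f (l i))) * mat_adjoint U"
    using mat_fun_spectral_form[OF assms(2)] A by auto
  show "mat_fun f A \<in> carrier_mat d d" unfolding eq using Uc by auto
  then show "spectral_form (mat_fun f A) U (\<lambda>i. f (l i))"
    using U eq by (auto simp: spectral_form_def)
qed

text \<open>After swapping the sums, each eigenvalue is multiplied by the squared norm of a column
  of \<open>U\<close>, which is 1.\<close>

lemma spectral_form_mtrace:
  assumes A: "A \<in> carrier_mat d d" and s: "spectral_form A U l"
  shows "mtrace A = complex_of_real (\<Sum>i<d. l i)"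
proof -
  have U: "unitary_mat d U" using assms by (auto simp: spectral_form_def)
  note Uc = unitary_matD[OF U]
  have "mtrace A = (\<Sum>i<d. \<Sum>k<d. U $$ (i, k) * complex_of_real (l k) * cnj (U $$ (i, k)))"
    using A spectral_formD(2)[OF s A] mat_diag_sandwich_index[OF Uc(1)] by (auto simp: mtrace_def intro!: sum.cong)
  also have "\<dots> = (\<Sum>k<d. \<Sum>i<d. U $$ (i, k) * complex_of_real (l k) * cnj (U $$ (i, k)))"
    by (rule sum.swap)
  also have "\<dots> = (\<Sum>k<d. complex_of_real (l k))"
  proof (rule sum.cong[OF refl])
    fix k assume "k \<in> {..<d}"
    then have k: "k < d" by simp
    have "(\<Sum>i<d. U $$ (i, k) * complex_of_real (l k) * cnj (U $$ (i, k)))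
      = complex_of_real (l k) * (\<Sum>i<d. mat_adjoint U $$ (k, i) * U $$ (i, k))"
      using Uc(1) k by (auto simp: sum_distrib_left intro!: sum.cong)
    also have "(\<Sum>i<d. mat_adjoint U $$ (k, i) * U $$ (i, k)) = (mat_adjoint U * U) $$ (k, k)"
      using Uc(1) k by (intro mult_mat_index[symmetric]) auto
    finally show "(\<Sum>i<d. U $$ (i, k) * complex_of_real (l k) * cnj (U $$ (i, k))) = complex_of_real (l k)"
      using k by (simp add: Uc(3))
  qed
  finally show ?thesis by simp
qed

text \<open>\<open>mat_adjoint A * A\<close> has the eigenvalues (l i)^2 in the same basis, so its
  square root has |l i|. From here on, norm estimates are inequalities between finite sums of
  reals.\<close>

lemma spectral_form_schatten_norm:
  assumes A: "A \<in> carrier_mat d d" and s: "spectral_form A U l"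
  shows "schatten_norm p A = (\<Sum>i<d. \<bar>l i\<bar> powr p) powr (1 / p)"
proof -
  have U: "unitary_mat d U" using assms by (auto simp: spectral_form_def)
  note Uc = unitary_matD[OF U]
  let ?L = "mat_diag d (\<lambda>i. complex_of_real (l i))"
  have L: "?L \<in> carrier_mat d d" by simp
  note assoc = assoc_mult_mat[of _ d d _ d _ d] mult_carrier_mat[of _ d d _ d]
  have AL: "A = U * ?L * mat_adjoint U" by (rule spectral_formD[OF s A])
  have Lh: "mat_adjoint ?L = ?L"
    by (rule eq_matI) (auto simp: mat_diag_def)
  have "mat_adjoint A = U * ?L * mat_adjoint U"
    using Uc(1) L by (subst AL) (simp add: mat_adjoint_mult[of _ d d _ d] Lh assoc)
  then have "mat_adjoint A * A = U * ?L * mat_adjoint U * (U * ?L * mat_adjoint U)"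
    using AL by simp
  also have "\<dots> = U * ?L * (mat_adjoint U * (U * (?L * mat_adjoint U)))"
    using Uc(1) L by (simp add: assoc)
  also have "mat_adjoint U * (U * (?L * mat_adjoint U)) = mat_adjoint U * U * (?L * mat_adjoint U)"
    using Uc(1) L by (intro assoc(1)[symmetric]) (auto intro!: mult_carrier_mat[of _ d d])
  also have "\<dots> = ?L * mat_adjoint U"
    unfolding Uc(3) by (intro left_mult_one_mat[of _ d d] mult_carrier_mat[of _ d d] L mat_adjoint_carrier Uc(1))
  also have "U * ?L * (?L * mat_adjoint U) = U * (?L * ?L) * mat_adjoint U"
    using Uc(1) L by (simp add: assoc del: mat_diag_diag)
  finally have "mat_adjoint A * A = U * mat_diag d (\<lambda>i. complex_of_real ((l i)\<^sup>2)) * mat_adjoint U"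
    by (simp add: power2_eq_square)
  moreover have AA: "mat_adjoint A * A \<in> carrier_mat d d" using A by auto
  ultimately have "spectral_form (mat_adjoint A * A) U (\<lambda>i. (l i)\<^sup>2)"
    using U by (intro spectral_formI)
  note abs = spectral_form_mat_fun[OF AA this, of sqrt, folded mat_abs_def]
  note pow = spectral_form_mat_fun[OF abs(2,1), of "\<lambda>x. x powr p"]
  show ?thesis unfolding schatten_norm_def spectral_form_mtrace[OF pow(2,1)] by simp
qed

section \<open>Spectra of density operators\<close>

text \<open>This is A U = U diag(l), read column by column.\<close>

lemma spectral_form_eigenvector:
  assumes A: "A \<in> carrier_mat d d" and s: "spectral_form A U l" and i: "i < d"
  shows "A *\<^sub>v col U i = complex_of_real (l i) \<cdot>\<^sub>v col U i"
proof -
  have U: "unitary_mat d U" and AU: "A = U * mat_diag d (\<lambda>i. complex_of_real (l i)) * mat_adjoint U"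
    using spectral_formD[OF s A] .
  note Uc = unitary_matD[OF U]
  let ?L = "mat_diag d (\<lambda>i. complex_of_real (l i))"
  have UL: "U * ?L \<in> carrier_mat d d" using Uc(1) by auto
  have "A * U = U * ?L * (mat_adjoint U * U)"
    by (subst AU) (rule assoc_mult_mat[OF UL mat_adjoint_carrier[OF Uc(1)] Uc(1)])
  also have "\<dots> = U * ?L" unfolding Uc(3) by (rule right_mult_one_mat[OF UL])
  finally have "A *\<^sub>v col U i = col (U * ?L) i"
    using col_mult2[OF A Uc(1) i] by simp
  also have "\<dots> = complex_of_real (l i) \<cdot>\<^sub>v col U i"
    using Uc(1) i by (intro eq_vecI) (auto simp: mat_diag_mult_right[OF Uc(1)])
  finally show ?thesis .
qed

lemma unitary_mat_col_carrier: "unitary_mat d U \<Longrightarrow> col U i \<in> carrier_vec d"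
  by (metis col_dim carrier_matD(1) unitary_matD(1))

lemma unitary_mat_col_norm:
  assumes "unitary_mat d U" "i < d"
  shows "l2_norm (col U i) = 1"
proof -
  note Uc = unitary_matD[OF assms(1)]
  have "(mat_adjoint U * U) $$ (i, i) = (\<Sum>k<d. cnj (U $$ (k, i)) * U $$ (k, i))"
    using Uc(1) assms(2) by (subst mult_mat_index[of _ d d _ d]) auto
  also have "\<dots> = col U i \<bullet>c col U i"
    using Uc(1) assms(2) by (subst cscalar_prod_sum[of _ d]) (auto simp: mult.commute)
  also have "\<dots> = complex_of_real ((l2_norm (col U i))\<^sup>2)" by (rule l2_norm_square[symmetric])
  finally have "(l2_norm (col U i))\<^sup>2 = 1"
    using Uc(3) assms(2) by (metis index_one_mat(1) of_real_eq_1_iff)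
  then show ?thesis by (simp add: l2_norm_def sum_nonneg)
qed

lemma l2_norm_smult: "l2_norm (c \<cdot>\<^sub>v v) = cmod c * l2_norm v"
  by (simp add: l2_norm_def norm_mult power_mult_distrib sum_distrib_left[symmetric] real_sqrt_mult)

lemma spectral_form_eigenvalue:
  assumes A: "A \<in> carrier_mat d d" and s: "spectral_form A U l" and i: "i < d"
  shows "(A *\<^sub>v col U i) \<bullet>c col U i = complex_of_real (l i)"
proof -
  have U: "unitary_mat d U" using spectral_formD[OF s A] by simp
  have "(A *\<^sub>v col U i) \<bullet>c col U i = complex_of_real (l i) * (col U i \<bullet>c col U i)"
    unfolding spectral_form_eigenvector[OF A s i] by simp
  then show ?thesis
    unfolding l2_norm_square[symmetric] unitary_mat_col_norm[OF U i] by simp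
qed

text \<open>In the coordinates \<open>mat_adjoint U *\<^sub>v v\<close> the form is diagonal. The
  weights add up to the squared norm of \<open>v\<close>, so for a unit vector the value is a
  weighted mean of the eigenvalues.\<close>

lemma spectral_form_cscalar_prod:
  assumes A: "A \<in> carrier_mat d d" and s: "spectral_form A U l" and v: "v \<in> carrier_vec d"
  shows "(A *\<^sub>v v) \<bullet>c v = complex_of_real (\<Sum>i<d. l i * (cmod ((mat_adjoint U *\<^sub>v v) $ i))\<^sup>2)"
proof -
  have U: "unitary_mat d U" and AU: "A = U * mat_diag d (\<lambda>i. complex_of_real (l i)) * mat_adjoint U"
    using spectral_formD[OF s A] .
  note Uc = unitary_matD[OF U]
  let ?L = "mat_diag d (\<lambda>i. complex_of_real (l i))"
  define y where "y = mat_adjoint U *\<^sub>v v"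
  have y: "y \<in> carrier_vec d" unfolding y_def by (rule mult_mat_vec_carrier[OF mat_adjoint_carrier[OF Uc(1)] v])
  have L: "?L \<in> carrier_mat d d" by simp
  have "A *\<^sub>v v = U *\<^sub>v (?L *\<^sub>v y)"
    unfolding y_def AU
    using Uc(1) L v
    by (simp add: assoc_mult_mat_vec[of _ d d _ d] mult_carrier_mat[of _ d d _ d] mult_mat_vec_carrier[of _ d d])
  then have "(A *\<^sub>v v) \<bullet>c v = (?L *\<^sub>v y) \<bullet>c y"
    unfolding y_def using Uc(1) v y
    by (simp add: cscalar_prod_mat_adjoint[of _ d d] y_def[symmetric] mult_mat_vec_carrier[OF L])
  also have "\<dots> = (\<Sum>i<d. (?L *\<^sub>v y) $ i * cnj (y $ i))"
    by (subst cscalar_prod_sum[OF y]) simp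
  also have "\<dots> = (\<Sum>i<d. complex_of_real (l i * (cmod (y $ i))\<^sup>2))"
  proof (rule sum.cong[OF refl])
    fix i assume "i \<in> {..<d}"
    then have "(?L *\<^sub>v y) $ i = complex_of_real (l i) * y $ i"
      by (subst mult_mat_vec_index[OF L y]) (auto simp: mat_diag_def if_distrib if_distribR cong: if_cong)
    then show "(?L *\<^sub>v y) $ i * cnj (y $ i) = complex_of_real (l i * (cmod (y $ i))\<^sup>2)"
      by (simp only: of_real_mult complex_norm_square mult.assoc)
  qed
  finally show ?thesis by (simp add: y_def)
qed

lemma density_opsD:
  assumes "\<rho> \<in> density_ops d"
  shows "\<rho> \<in> carrier_mat d d" "mtrace \<rho> = 1" "psd_mat d \<rho>"
  using assms by (auto simp: density_ops_def psd_mat_def)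

text \<open>Positivity is tested on the columns of \<open>U\<close>, and the sum is the trace: the
  spectrum is a probability vector.\<close>

lemma density_ops_spectrum:
  assumes "\<rho> \<in> density_ops d"
  obtains U l where "spectral_form \<rho> U l" "\<And>i. i < d \<Longrightarrow> 0 \<le> l i" "(\<Sum>i<d. l i) = 1"
proof -
  note D = density_opsD[OF assms]
  obtain U l where s: "spectral_form \<rho> U l" using psd_mat_spectral_form D(3) by blast
  have c: "col U i \<in> carrier_vec d" for i
    using spectral_formD[OF s D(1)] by (simp add: unitary_mat_col_carrier)
  have "0 \<le> l i" if "i < d" for i
    using D(3) c[of i] spectral_form_eigenvalue[OF D(1) s that]
    by (auto simp: psd_mat_def less_eq_complex_def dest!: bspec[of _ _ "col U i"])
  moreover have "complex_of_real (\<Sum>i<d. l i) = 1"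
    using spectral_form_mtrace[OF D(1) s] D(2) by simp
  then have "(\<Sum>i<d. l i) = 1" using of_real_eq_1_iff by blast
  ultimately show ?thesis using that s by blast
qed

text \<open>Split x^p = x * x^(p - 1), bound the second factor by c^(p - 1), and use that the
  weights sum to 1.\<close>

lemma sum_powr_le:
  fixes l :: "nat \<Rightarrow> real"
  assumes "1 < p" "\<And>i. i < d \<Longrightarrow> 0 \<le> l i" "\<And>i. i < d \<Longrightarrow> l i \<le> c" "(\<Sum>i<d. l i) = 1"
  shows "(\<Sum>i<d. \<bar>l i\<bar> powr p) powr (1 / p) \<le> c powr (1 - 1 / p)"
proof -
  have "0 < d" using assms(4) by (cases d) auto
  then have c: "0 \<le> c" using assms(2,3) order_trans by blast
  have "(\<Sum>i<d. \<bar>l i\<bar> powr p) \<le> (\<Sum>i<d. l i * c powr (p - 1))"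
  proof (rule sum_mono)
    fix i assume "i \<in> {..<d}"
    then have i: "0 \<le> l i" "l i \<le> c" using assms by auto
    have "\<bar>l i\<bar> powr p = l i * l i powr (p - 1)"
      using i by (cases "l i = 0") (auto simp: powr_mult_base)
    also have "\<dots> \<le> l i * c powr (p - 1)"
      using i assms(1) by (intro mult_left_mono powr_mono2) auto
    finally show "\<bar>l i\<bar> powr p \<le> l i * c powr (p - 1)" .
  qed
  also have "\<dots> = c powr (p - 1)" using assms(4) by (simp add: sum_distrib_right[symmetric])
  finally have "(\<Sum>i<d. \<bar>l i\<bar> powr p) powr (1 / p) \<le> (c powr (p - 1)) powr (1 / p)"
    using assms(1) by (intro powr_mono2) (auto intro: sum_nonneg)
  also have "\<dots> = c powr (1 - 1 / p)"
    using assms(1) by (simp add: powr_powr diff_divide_distrib)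
  finally show ?thesis .
qed

lemma schatten_norm_nonneg: "0 \<le> schatten_norm p A"
  by (simp add: schatten_norm_def)

text \<open>A crude bound, with each eigenvalue at most the trace. It serves to make the supremum
  for the product channel one over a bounded set.\<close>

lemma density_schatten_norm_le_1:
  assumes "\<rho> \<in> density_ops d" "1 < p"
  shows "schatten_norm p \<rho> \<le> 1"
proof -
  obtain U l where s: "spectral_form \<rho> U l" and l: "\<And>i. i < d \<Longrightarrow> 0 \<le> l i" "(\<Sum>i<d. l i) = 1"
    using density_ops_spectrum[OF assms(1)] by metis
  have "l i \<le> 1" if "i < d" for i
    using member_le_sum[of i "{..<d}" l] l that by auto
  then show ?thesis
    using sum_powr_le[OF assms(2) l(1) _ l(2), of 1] spectral_form_schatten_norm[OF density_opsD(1)[OF assms(1)] s]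
    by simp
qed

text \<open>The form at \<open>v\<close> is a weighted mean of eigenvalues, so some eigenvalue
  reaches \<open>c\<close>; its single term already bounds the norm from below.\<close>

lemma density_schatten_norm_ge:
  assumes \<rho>: "\<rho> \<in> density_ops d" and p: "1 < p" and v: "v \<in> carrier_vec d" "l2_norm v = 1"
    and c: "0 \<le> c" "complex_of_real c \<le> (\<rho> *\<^sub>v v) \<bullet>c v"
  shows "c \<le> schatten_norm p \<rho>"
proof -
  obtain U l where s: "spectral_form \<rho> U l" and l: "\<And>i. i < d \<Longrightarrow> 0 \<le> l i"
    using density_ops_spectrum[OF \<rho>] by metis
  note D = density_opsD[OF \<rho>]
  have U: "unitary_mat d U" using spectral_formD[OF s D(1)] by simp
  define w where "w i = (cmod ((mat_adjoint U *\<^sub>v v) $ i))\<^sup>2" for i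
  have "l2_norm (mat_adjoint U *\<^sub>v v) = 1"
    using unitary_mat_l2_norm[OF unitary_mat_adjoint[OF U] v(1)] v(2) by simp
  then have "(\<Sum>i<dim_vec (mat_adjoint U *\<^sub>v v). w i) = 1"
    unfolding l2_norm_def w_def by simp
  then have w1: "(\<Sum>i<d. w i) = 1" using unitary_matD(1)[OF U] by simp
  have cw: "c \<le> (\<Sum>i<d. l i * w i)"
    using c(2) unfolding spectral_form_cscalar_prod[OF D(1) s v(1)] w_def
    by (simp add: less_eq_complex_def del: of_real_sum)
  have "\<exists>i<d. c \<le> l i"
  proof (rule ccontr)
    assume "\<not> (\<exists>i<d. c \<le> l i)"
    then have lt: "l i < c" if "i < d" for i using that by force
    \<comment> \<open>The weights sum to 1, so one of them is positive; at that index the comparison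
      is strict.\<close>
    obtain k where k: "k < d" "0 < w k"
      using w1 sum_nonpos[of "{..<d}" w] by force
    have "(\<Sum>i<d. l i * w i) < (\<Sum>i<d. c * w i)"
    proof (rule sum_strict_mono_ex1)
      show "\<exists>i\<in>{..<d}. l i * w i < c * w i"
        using k lt by (intro bexI[of _ k]) auto
    qed (use lt in \<open>auto intro!: mult_right_mono[OF less_imp_le] simp: w_def\<close>)
    also have "\<dots> = c" using w1 by (simp add: sum_distrib_left[symmetric])
    finally show False using cw by simp
  qed
  then obtain i where i: "i < d" "c \<le> l i" by blast
  have "c \<le> (\<bar>l i\<bar> powr p) powr (1 / p)"
    using i l[OF i(1)] p by (simp add: powr_powr)
  also have "\<dots> \<le> (\<Sum>i<d. \<bar>l i\<bar> powr p) powr (1 / p)"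
    using i p by (intro powr_mono2 member_le_sum) auto
  finally show ?thesis unfolding spectral_form_schatten_norm[OF D(1) s] .
qed

section \<open>Operator norm and eigenvalues\<close>

text \<open>The content is that the supremum is over a bounded set: coordinates of a unit vector
  have modulus at most 1, so absolute row sums bound every image vector.\<close>

lemma op_norm_ge:
  assumes A: "A \<in> carrier_mat d e" and v: "v \<in> carrier_vec e" "l2_norm v = 1"
  shows "l2_norm (A *\<^sub>v v) \<le> op_norm A"
proof -
  have "l2_norm (A *\<^sub>v u) \<le> sqrt (\<Sum>i<d. (\<Sum>j<e. cmod (A $$ (i, j)))\<^sup>2)"
    if u: "u \<in> carrier_vec e" "l2_norm u = 1" for u
  proof -
    have "(\<Sum>j<e. (cmod (u $ j))\<^sup>2) = 1" using u by (simp add: l2_norm_def)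
    then have "(cmod (u $ j))\<^sup>2 \<le> 1" if "j < e" for j
      using member_le_sum[of j "{..<e}" "\<lambda>j. (cmod (u $ j))\<^sup>2"] that by simp
    then have u1: "cmod (u $ j) \<le> 1" if "j < e" for j
      using that power2_le_imp_le[of "cmod (u $ j)" 1] by simp
    have "cmod ((A *\<^sub>v u) $ i) \<le> (\<Sum>j<e. cmod (A $$ (i, j)))" if i: "i < d" for i
    proof -
      have "cmod ((A *\<^sub>v u) $ i) \<le> (\<Sum>j<e. cmod (A $$ (i, j) * u $ j))"
        by (subst mult_mat_vec_index[OF A u(1) i]) (rule norm_sum)
      also have "\<dots> \<le> (\<Sum>j<e. cmod (A $$ (i, j)))"
        using u1 by (intro sum_mono) (auto simp: norm_mult intro: mult_left_le)
      finally show ?thesis .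
    qed
    then show ?thesis
      using A unfolding l2_norm_def by (auto intro!: real_sqrt_le_mono sum_mono power_mono)
  qed
  then have "bdd_above ((\<lambda>v. l2_norm (A *\<^sub>v v)) ` {v \<in> carrier_vec (dim_col A). l2_norm v = 1})"
    using A by (intro bdd_aboveI2) auto
  then show ?thesis
    unfolding op_norm_def using A v by (intro cSUP_upper) auto
qed

lemma smult_mat_mult_vec:
  fixes A :: "'a::comm_ring_1 mat"
  shows "A \<in> carrier_mat n m \<Longrightarrow> v \<in> carrier_vec m \<Longrightarrow> (k \<cdot>\<^sub>m A) *\<^sub>v v = k \<cdot>\<^sub>v (A *\<^sub>v v)"
  by (intro eq_vecI) auto

text \<open>An eigenvector of the matrix is also one of its difference from I/d, with eigenvalue
  shifted by 1/d; the norm is tested on this unit vector.\<close>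

lemma spectral_form_eigenvalue_op_norm:
  assumes \<rho>: "\<rho> \<in> carrier_mat d d" and s: "spectral_form \<rho> U l" and i: "i < d"
  shows "\<bar>l i - 1 / real d\<bar> \<le> op_norm (\<rho> - (1 / of_nat d) \<cdot>\<^sub>m 1\<^sub>m d)"
proof -
  let ?A = "\<rho> - (1 / of_nat d) \<cdot>\<^sub>m 1\<^sub>m d" and ?u = "col U i"
  have U: "unitary_mat d U" using spectral_formD[OF s \<rho>] by simp
  have u: "?u \<in> carrier_vec d" by (rule unitary_mat_col_carrier[OF U])
  have A: "?A \<in> carrier_mat d d"
    by (intro minus_carrier_mat smult_carrier_mat one_carrier_mat)
  have "?A *\<^sub>v ?u = \<rho> *\<^sub>v ?u - (1 / of_nat d) \<cdot>\<^sub>v ?u"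
    using \<rho> u by (simp add: minus_mult_distrib_mat_vec[of _ d d] smult_mat_mult_vec[of _ d d])
  also have "\<dots> = complex_of_real (l i - 1 / real d) \<cdot>\<^sub>v ?u"
    unfolding spectral_form_eigenvector[OF \<rho> s i] using u by (intro eq_vecI) (auto simp: algebra_simps)
  finally show ?thesis
    using op_norm_ge[OF A u unitary_mat_col_norm[OF U i]] unitary_mat_col_norm[OF U i]
    by (simp only: l2_norm_smult norm_of_real mult_1_right)
qed

lemma density_schatten_norm_le:
  assumes \<rho>: "\<rho> \<in> density_ops d" and p: "1 < p"
    and op: "op_norm (\<rho> - (1 / of_nat d) \<cdot>\<^sub>m 1\<^sub>m d) \<le> \<epsilon> / real d"
  shows "schatten_norm p \<rho> \<le> ((1 + \<epsilon>) / real d) powr (1 - 1 / p)"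
proof -
  obtain U l where s: "spectral_form \<rho> U l" and l: "\<And>i. i < d \<Longrightarrow> 0 \<le> l i" "(\<Sum>i<d. l i) = 1"
    using density_ops_spectrum[OF \<rho>] by metis
  note D = density_opsD[OF \<rho>]
  have "l i \<le> (1 + \<epsilon>) / real d" if "i < d" for i
    using spectral_form_eigenvalue_op_norm[OF D(1) s that] op by (simp add: add_divide_distrib)
  then show ?thesis
    unfolding spectral_form_schatten_norm[OF D(1) s] by (intro sum_powr_le p l)
qed

section \<open>Random unitary channels and complex conjugation\<close>

lemma random_unitary_map_carrier: "random_unitary_map d n V \<rho> \<in> carrier_mat d d"
  by (simp add: random_unitary_map_def)

lemma random_unitary_map_index:
  "r < d \<Longrightarrow> s < d \<Longrightarrow> random_unitary_map d n V \<rho> $$ (r, s)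
    = (1 / of_nat n) * (\<Sum>i<n. (V i * \<rho> * mat_adjoint (V i)) $$ (r, s))"
  by (simp add: random_unitary_map_def)

lemma quadratic_form_sum:
  fixes A :: "complex mat"
  assumes "A \<in> carrier_mat d d" "v \<in> carrier_vec d"
  shows "(A *\<^sub>v v) \<bullet>c v = (\<Sum>r<d. \<Sum>s<d. A $$ (r, s) * v $ s * cnj (v $ r))"
  by (simp add: cscalar_prod_sum[OF assms(2)] mult_mat_vec_index[OF assms] sum_distrib_right)

text \<open>Each unitary is moved from the state to the vector as its adjoint. This yields the
  positivity of outputs and later the overlap with the maximally entangled state.\<close>

lemma random_unitary_map_quadratic_form:
  assumes \<rho>: "\<rho> \<in> carrier_mat d d" and V: "\<And>i. i < n \<Longrightarrow> V i \<in> carrier_mat d d"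
    and v: "v \<in> carrier_vec d"
  shows "(random_unitary_map d n V \<rho> *\<^sub>v v) \<bullet>c v
    = (1 / of_nat n) * (\<Sum>i<n. (\<rho> *\<^sub>v (mat_adjoint (V i) *\<^sub>v v)) \<bullet>c (mat_adjoint (V i) *\<^sub>v v))"
proof -
  let ?M = "\<lambda>i. V i * \<rho> * mat_adjoint (V i)"
  have M: "?M i \<in> carrier_mat d d" if "i < n" for i
    using V[OF that] \<rho> by auto
  have "(random_unitary_map d n V \<rho> *\<^sub>v v) \<bullet>c v
    = (\<Sum>r<d. \<Sum>s<d. (1 / of_nat n) * (\<Sum>i<n. ?M i $$ (r, s) * v $ s * cnj (v $ r)))"
    unfolding quadratic_form_sum[OF random_unitary_map_carrier v]
    by (intro sum.cong refl) (simp add: random_unitary_map_index sum_distrib_right del: index_mult_mat)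
  also have "\<dots> = (1 / of_nat n) * (\<Sum>r<d. \<Sum>s<d. \<Sum>i<n. ?M i $$ (r, s) * v $ s * cnj (v $ r))"
    by (simp only: sum_distrib_left)
  also have "(\<Sum>r<d. \<Sum>s<d. \<Sum>i<n. ?M i $$ (r, s) * v $ s * cnj (v $ r))
    = (\<Sum>r<d. \<Sum>i<n. \<Sum>s<d. ?M i $$ (r, s) * v $ s * cnj (v $ r))"
    by (intro sum.cong refl sum.swap)
  also have "\<dots> = (\<Sum>i<n. \<Sum>r<d. \<Sum>s<d. ?M i $$ (r, s) * v $ s * cnj (v $ r))"
    by (rule sum.swap)
  also have "\<dots> = (\<Sum>i<n. (?M i *\<^sub>v v) \<bullet>c v)"
    by (intro sum.cong refl quadratic_form_sum[OF M v, symmetric]) simp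
  also have "\<dots> = (\<Sum>i<n. (\<rho> *\<^sub>v (mat_adjoint (V i) *\<^sub>v v)) \<bullet>c (mat_adjoint (V i) *\<^sub>v v))"
  proof (rule sum.cong[OF refl])
    fix i assume "i \<in> {..<n}"
    then have Vi: "V i \<in> carrier_mat d d" using V by simp
    have w: "mat_adjoint (V i) *\<^sub>v v \<in> carrier_vec d"
      by (rule mult_mat_vec_carrier[OF mat_adjoint_carrier[OF Vi] v])
    have "?M i *\<^sub>v v = V i *\<^sub>v (\<rho> *\<^sub>v (mat_adjoint (V i) *\<^sub>v v))"
      using Vi \<rho> v w
      by (simp add: assoc_mult_mat_vec[of _ d d _ d] mult_carrier_mat[of _ d d _ d])
    then show "(?M i *\<^sub>v v) \<bullet>c v = (\<rho> *\<^sub>v (mat_adjoint (V i) *\<^sub>v v)) \<bullet>c (mat_adjoint (V i) *\<^sub>v v)"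
      using cscalar_prod_mat_adjoint[OF Vi mult_mat_vec_carrier[OF \<rho> w] v] by simp
  qed
  finally show ?thesis .
qed

lemma mtrace_mult_commute:
  assumes A: "A \<in> carrier_mat n m" and B: "B \<in> carrier_mat m n"
  shows "mtrace (A * B) = mtrace (B * A)"
proof -
  have "mtrace (A * B) = (\<Sum>i<n. \<Sum>j<m. A $$ (i, j) * B $$ (j, i))"
    using A mult_mat_index[OF A B] by (simp add: mtrace_def del: index_mult_mat(1))
  also have "\<dots> = (\<Sum>j<m. \<Sum>i<n. B $$ (j, i) * A $$ (i, j))"
    by (subst sum.swap) (simp add: mult.commute)
  also have "\<dots> = mtrace (B * A)"
    using B mult_mat_index[OF B A] by (simp add: mtrace_def del: index_mult_mat(1))
  finally show ?thesis .
qed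

lemma mtrace_unitary_conj:
  assumes U: "unitary_mat d U" and A: "A \<in> carrier_mat d d"
  shows "mtrace (U * A * mat_adjoint U) = mtrace A"
proof -
  note Uc = unitary_matD[OF U]
  have "mtrace (U * A * mat_adjoint U) = mtrace (mat_adjoint U * (U * A))"
    using Uc(1) A by (intro mtrace_mult_commute[of _ d d]) auto
  also have "mat_adjoint U * (U * A) = mat_adjoint U * U * A"
    using Uc(1) A by (intro assoc_mult_mat[symmetric]) auto
  also have "\<dots> = A" using Uc A by simp
  finally show ?thesis .
qed

text \<open>Positivity holds term by term, and the trace is invariant under unitary conjugation.
  Outputs thus have probability vectors as spectra, also for the product channel in dimension d *
  d.\<close>

lemma random_unitary_map_density:
  assumes \<rho>: "\<rho> \<in> density_ops d" and V: "\<And>i. i < n \<Longrightarrow> unitary_mat d (V i)" and n: "0 < n"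
  shows "random_unitary_map d n V \<rho> \<in> density_ops d"
proof -
  note D = density_opsD[OF \<rho>]
  have Vc: "V i \<in> carrier_mat d d" if "i < n" for i using unitary_matD(1)[OF V[OF that]] .
  have "0 \<le> (random_unitary_map d n V \<rho> *\<^sub>v v) \<bullet>c v" if v: "v \<in> carrier_vec d" for v
  proof -
    have "0 \<le> (\<rho> *\<^sub>v (mat_adjoint (V i) *\<^sub>v v)) \<bullet>c (mat_adjoint (V i) *\<^sub>v v)" if "i < n" for i
      using D(3) mult_mat_vec_carrier[OF mat_adjoint_carrier[OF Vc[OF that]] v]
      unfolding psd_mat_def by blast
    then have "0 \<le> (\<Sum>i<n. (\<rho> *\<^sub>v (mat_adjoint (V i) *\<^sub>v v)) \<bullet>c (mat_adjoint (V i) *\<^sub>v v))"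
      by (intro sum_nonneg) simp
    moreover have "0 \<le> (1 / of_nat n :: complex)"
      by (simp add: less_eq_complex_def)
    ultimately show ?thesis
      by (subst random_unitary_map_quadratic_form[OF D(1) Vc v]) (assumption, rule mult_nonneg_nonneg)
  qed
  moreover have "mtrace (random_unitary_map d n V \<rho>) = 1"
  proof -
    have "mtrace (random_unitary_map d n V \<rho>)
      = (1 / of_nat n) * (\<Sum>r<d. \<Sum>i<n. (V i * \<rho> * mat_adjoint (V i)) $$ (r, r))"
      by (simp add: mtrace_def random_unitary_map_index carrier_matD(1)[OF random_unitary_map_carrier] sum_distrib_left
          del: index_mult_mat(1))
    also have "(\<Sum>r<d. \<Sum>i<n. (V i * \<rho> * mat_adjoint (V i)) $$ (r, r))
      = (\<Sum>i<n. \<Sum>r<d. (V i * \<rho> * mat_adjoint (V i)) $$ (r, r))"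
      by (rule sum.swap)
    also have "\<dots> = (\<Sum>i<n. mtrace (V i * \<rho> * mat_adjoint (V i)))"
      using Vc by (auto simp: mtrace_def intro!: sum.cong simp del: index_mult_mat(1))
    also have "\<dots> = (\<Sum>i<n. 1)"
      using mtrace_unitary_conj[OF V D(1)] D(2) by (intro sum.cong) auto
    finally show ?thesis using n by simp
  qed
  ultimately show ?thesis
    by (auto simp: density_ops_def psd_mat_def random_unitary_map_carrier)
qed

section \<open>Entrywise complex conjugation\<close>

lemma map_mat_cnj_mult:
  assumes A: "A \<in> carrier_mat n m" and B: "B \<in> carrier_mat m k"
  shows "map_mat cnj (A * B) = map_mat cnj A * map_mat cnj B"
proof (rule eq_matI)
  fix i j assume "i < dim_row (map_mat cnj A * map_mat cnj B)" "j < dim_col (map_mat cnj A * map_mat cnj B)"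
  then have ij: "i < n" "j < k" using A B by auto
  have "(map_mat cnj A * map_mat cnj B) $$ (i, j) = (\<Sum>l<m. map_mat cnj A $$ (i, l) * map_mat cnj B $$ (l, j))"
    using A B ij by (intro mult_mat_index) auto
  also have "\<dots> = cnj ((A * B) $$ (i, j))"
    unfolding mult_mat_index[OF A B ij] using A B ij by auto
  finally show "map_mat cnj (A * B) $$ (i, j) = (map_mat cnj A * map_mat cnj B) $$ (i, j)"
    using A B ij by (simp del: index_mult_mat(1))
qed (use A B in auto)

lemma map_mat_cnj_adjoint: "mat_adjoint (map_mat cnj A) = map_mat cnj (mat_adjoint A)"
  by (rule eq_matI) auto

lemma map_mat_cnj_cnj [simp]: "map_mat cnj (map_mat cnj A) = A"
  by (rule eq_matI) auto

lemma unitary_mat_cnj: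
  assumes U: "unitary_mat d U"
  shows "unitary_mat d (map_mat cnj U)"
proof (rule unitary_matI)
  note Uc = unitary_matD[OF U]
  have "mat_adjoint (map_mat cnj U) * map_mat cnj U = map_mat cnj (mat_adjoint U * U)"
    using Uc(1) by (simp add: map_mat_cnj_adjoint map_mat_cnj_mult[of _ d d _ d])
  also have "\<dots> = 1\<^sub>m d"
    unfolding Uc(3) by (rule eq_matI) auto
  finally show "mat_adjoint (map_mat cnj U) * map_mat cnj U = 1\<^sub>m d" .
qed (use unitary_matD[OF U] in auto)

lemma quadratic_form_cnj:
  assumes "A \<in> carrier_mat d d" "v \<in> carrier_vec d"
  shows "(map_mat cnj A *\<^sub>v v) \<bullet>c v = cnj ((A *\<^sub>v conjugate v) \<bullet>c conjugate v)"
proof -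
  have "conjugate v \<in> carrier_vec d" "map_mat cnj A \<in> carrier_mat d d" using assms by auto
  then show ?thesis
    using assms by (auto simp: quadratic_form_sum simp del: conjugate_id intro!: sum.cong)
qed

lemma density_ops_cnj:
  assumes "\<rho> \<in> density_ops d"
  shows "map_mat cnj \<rho> \<in> density_ops d"
proof -
  note D = density_opsD[OF assms]
  have "0 \<le> (map_mat cnj \<rho> *\<^sub>v v) \<bullet>c v" if v: "v \<in> carrier_vec d" for v
  proof -
    have "0 \<le> (\<rho> *\<^sub>v conjugate v) \<bullet>c conjugate v"
      using D(3) v unfolding psd_mat_def by (meson carrier_vec_conjugate)
    then show ?thesis
      unfolding quadratic_form_cnj[OF D(1) v] by (simp add: less_eq_complex_def del: conjugate_id)
  qed
  moreover have "mtrace (map_mat cnj \<rho>) = cnj (mtrace \<rho>)"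
    using D(1) by (auto simp: mtrace_def)
  ultimately show ?thesis
    using D by (auto simp: density_ops_def psd_mat_def)
qed

text \<open>Conjugation is multiplicative and fixes the real diagonal, so the conjugated unitary
  diagonalises with the same eigenvalues.\<close>

lemma spectral_form_cnj:
  assumes A: "A \<in> carrier_mat d d" and s: "spectral_form A U l"
  shows "spectral_form (map_mat cnj A) (map_mat cnj U) l"
proof (rule spectral_formI[of _ d])
  note sD = spectral_formD[OF s A]
  note Uc = unitary_matD[OF sD(1)]
  let ?L = "mat_diag d (\<lambda>i. complex_of_real (l i))"
  have L: "map_mat cnj ?L = ?L" by (rule eq_matI) (auto simp: mat_diag_def)
  have UL: "U * ?L \<in> carrier_mat d d" using Uc(1) by auto
  show "unitary_mat d (map_mat cnj U)" using sD by (simp add: unitary_mat_cnj)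
  have "map_mat cnj A = map_mat cnj (U * ?L * mat_adjoint U)" using sD(2) by simp
  also have "\<dots> = map_mat cnj (U * ?L) * map_mat cnj (mat_adjoint U)"
    by (rule map_mat_cnj_mult[OF UL mat_adjoint_carrier[OF Uc(1)]])
  also have "map_mat cnj (U * ?L) = map_mat cnj U * ?L"
    using map_mat_cnj_mult[OF Uc(1) mat_diag_dim] by (simp only: L)
  finally show "map_mat cnj A = map_mat cnj U * ?L * mat_adjoint (map_mat cnj U)"
    by (simp only: map_mat_cnj_adjoint)
qed (use A in auto)

lemma density_schatten_norm_cnj:
  assumes "\<rho> \<in> density_ops d"
  shows "schatten_norm p (map_mat cnj \<rho>) = schatten_norm p \<rho>"
proof -
  note D = density_opsD[OF assms]
  obtain U l where s: "spectral_form \<rho> U l" using psd_mat_spectral_form D(3) by blast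
  have "map_mat cnj \<rho> \<in> carrier_mat d d" using D(1) by simp
  then show ?thesis
    using spectral_form_schatten_norm[OF D(1) s] spectral_form_schatten_norm[OF _ spectral_form_cnj[OF D(1) s]]
    by simp
qed

text \<open>The conjugate channel is the original one between two conjugations. Since conjugation
  preserves states and their norms, the randomizing hypothesis on the original channel bounds
  both.\<close>

lemma random_unitary_map_cnj:
  assumes \<rho>: "\<rho> \<in> carrier_mat d d" and V: "\<And>i. i < n \<Longrightarrow> V i \<in> carrier_mat d d"
  shows "random_unitary_map d n (\<lambda>i. map_mat cnj (V i)) \<rho> = map_mat cnj (random_unitary_map d n V (map_mat cnj \<rho>))"
    (is "?L = ?R")
proof (rule eq_matI)
  have cnj_conj: "map_mat cnj (V i) * \<rho> * mat_adjoint (map_mat cnj (V i))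
      = map_mat cnj (V i * map_mat cnj \<rho> * mat_adjoint (V i))" if "i < n" for i
    using V[OF that] \<rho>
    by (simp add: map_mat_cnj_mult[of _ d d _ d] mult_carrier_mat[of _ d d _ d] map_mat_cnj_adjoint)
  fix r s assume "r < dim_row ?R" "s < dim_col ?R"
  then have rs: "r < d" "s < d" by (auto simp: random_unitary_map_def)
  have "(map_mat cnj (V i) * \<rho> * mat_adjoint (map_mat cnj (V i))) $$ (r, s)
      = cnj ((V i * map_mat cnj \<rho> * mat_adjoint (V i)) $$ (r, s))" if "i < n" for i
    unfolding cnj_conj[OF that] using V[OF that] \<rho> rs by (simp del: index_mult_mat(1))
  then show "?L $$ (r, s) = ?R $$ (r, s)"
    using rs carrier_matD[OF random_unitary_map_carrier[of d n V]]
    by (simp add: random_unitary_map_index del: index_mult_mat(1))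
qed (auto simp: random_unitary_map_def)

lemma randomizing_cnj_schatten_norm_le:
  assumes V: "\<And>i. i < n \<Longrightarrow> unitary_mat d (V i)" and n: "0 < n" and p: "1 < p"
    and rand: "randomizing \<epsilon> d (random_unitary_map d n V)" and \<rho>: "\<rho> \<in> density_ops d"
  shows "schatten_norm p (random_unitary_map d n V \<rho>) \<le> ((1 + \<epsilon>) / real d) powr (1 - 1 / p)"
    and "schatten_norm p (random_unitary_map d n (\<lambda>i. map_mat cnj (V i)) \<rho>) \<le> ((1 + \<epsilon>) / real d) powr (1 - 1 / p)"
proof -
  have le: "schatten_norm p (random_unitary_map d n V \<sigma>) \<le> ((1 + \<epsilon>) / real d) powr (1 - 1 / p)"
    if "\<sigma> \<in> density_ops d" for \<sigma>
    using random_unitary_map_density[OF that V n] rand that p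
    by (intro density_schatten_norm_le) (auto simp: randomizing_def)
  show "schatten_norm p (random_unitary_map d n V \<rho>) \<le> ((1 + \<epsilon>) / real d) powr (1 - 1 / p)"
    using le \<rho> .
  note c = density_ops_cnj[OF \<rho>]
  show "schatten_norm p (random_unitary_map d n (\<lambda>i. map_mat cnj (V i)) \<rho>) \<le> ((1 + \<epsilon>) / real d) powr (1 - 1 / p)"
    using le[OF c] density_schatten_norm_cnj[OF random_unitary_map_density[OF c V n]]
    using random_unitary_map_cnj[OF density_opsD(1)[OF \<rho>] unitary_matD(1)[OF V]] by simp
qed

section \<open>Tensor products and the maximally entangled state\<close>

text \<open>The pairing i * e + k serves twice: for coordinates of the tensor product and for
  numbering the pairs of unitaries of the product channel.\<close>

lemma sum_lessThan_mult:
  fixes f :: "nat \<Rightarrow> 'a::comm_monoid_add"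
  shows "(\<Sum>x<d * e. f x) = (\<Sum>i<d. \<Sum>k<e. f (i * e + k))"
proof -
  have "sum f {i * e..<i * e + e} = (\<Sum>k<e. f (i * e + k))" for i
    using sum.shift_bounds_nat_ivl[of f 0 "i * e" e] by (simp add: atLeast0LessThan add.commute)
  then show ?thesis by (simp add: sum.nat_group[symmetric])
qed

lemma pair_index_less:
  assumes "i < d" "k < (e::nat)"
  shows "i * e + k < d * e"
proof -
  have "i * e + k < Suc i * e" using assms by simp
  also have "\<dots> \<le> d * e" using assms by (intro mult_le_mono1) simp
  finally show ?thesis .
qed

lemma pair_index_div_mod:
  assumes "r < d * (e::nat)"
  shows "r div e < d" "r mod e < e"
  using assms by (cases "e = 0"; auto simp: less_mult_imp_div_less)+

lemma kron_carrier:
  "A \<in> carrier_mat n m \<Longrightarrow> B \<in> carrier_mat k l \<Longrightarrow> kron A B \<in> carrier_mat (n * k) (m * l)"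
  by (auto simp: kron_def)

lemma kron_index:
  assumes "A \<in> carrier_mat n m" "B \<in> carrier_mat k l" "r < n * k" "s < m * l"
  shows "kron A B $$ (r, s) = A $$ (r div k, s div l) * B $$ (r mod k, s mod l)"
  using assms by (auto simp: kron_def)

lemma mat_adjoint_kron: "mat_adjoint (kron A B) = kron (mat_adjoint A) (mat_adjoint B)"
proof (rule eq_matI)
  fix i j assume "i < dim_row (kron (mat_adjoint A) (mat_adjoint B))" "j < dim_col (kron (mat_adjoint A) (mat_adjoint B))"
  then have "i < dim_col A * dim_col B" "j < dim_row A * dim_row B" by (auto simp: kron_def)
  then show "mat_adjoint (kron A B) $$ (i, j) = kron (mat_adjoint A) (mat_adjoint B) $$ (i, j)"
    using pair_index_div_mod[of i "dim_col A" "dim_col B"] pair_index_div_mod[of j "dim_row A" "dim_row B"]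
    by (simp add: kron_def)
qed (auto simp: kron_def)

text \<open>The sum over a paired index factors, so the Gram matrix of the Kronecker product is the
  Kronecker product of the Gram matrices.\<close>

lemma kron_unitary:
  assumes A: "unitary_mat d A" and B: "unitary_mat e B"
  shows "unitary_mat (d * e) (kron A B)"
proof (rule unitary_matI)
  note Ac = unitary_matD[OF A] and Bc = unitary_matD[OF B]
  show K: "kron A B \<in> carrier_mat (d * e) (d * e)" using Ac Bc kron_carrier by blast
  note aA = mat_adjoint_carrier[OF Ac(1)] and aB = mat_adjoint_carrier[OF Bc(1)]
  show "mat_adjoint (kron A B) * kron A B = 1\<^sub>m (d * e)"
  proof (rule eq_matI)
    fix i j assume "i < dim_row (1\<^sub>m (d * e) :: complex mat)" "j < dim_col (1\<^sub>m (d * e) :: complex mat)"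
    then have ij: "i < d * e" "j < d * e" by auto
    note dm = pair_index_div_mod[OF ij(1)] pair_index_div_mod[OF ij(2)]
    have "(mat_adjoint (kron A B) * kron A B) $$ (i, j)
      = (\<Sum>x<d * e. kron (mat_adjoint A) (mat_adjoint B) $$ (i, x) * kron A B $$ (x, j))"
      unfolding mat_adjoint_kron by (rule mult_mat_index[OF kron_carrier[OF aA aB] K ij])
    also have "\<dots> = (\<Sum>a<d. \<Sum>k<e. (mat_adjoint A $$ (i div e, a) * A $$ (a, j div e)) *
        (mat_adjoint B $$ (i mod e, k) * B $$ (k, j mod e)))"
      unfolding sum_lessThan_mult using ij
      by (intro sum.cong refl) (simp add: kron_index[OF aA aB] kron_index[OF Ac(1) Bc(1)] pair_index_less del: mat_adjoint_index)
    also have "\<dots> = (mat_adjoint A * A) $$ (i div e, j div e) * (mat_adjoint B * B) $$ (i mod e, j mod e)"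
      using dm by (simp only: mult_mat_index[OF aA Ac(1)] mult_mat_index[OF aB Bc(1)] sum_product)
    also have "\<dots> = (if i div e = j div e \<and> i mod e = j mod e then 1 else 0)"
      using dm by (simp add: Ac(3) Bc(3))
    \<comment> \<open>Quotient and remainder together determine the index.\<close>
    also have "\<dots> = 1\<^sub>m (d * e) $$ (i, j)"
      using ij by simp (metis div_mult_mod_eq)
    finally show "(mat_adjoint (kron A B) * kron A B) $$ (i, j) = 1\<^sub>m (d * e) $$ (i, j)" .
  qed (use K in auto)
qed

text \<open>A matrix unit is the rank-one matrix of two basis vectors, so conjugating it by
  \<open>V x\<close> pairs columns i and j of \<open>V x\<close>. \<open>tensor_map\<close>
  evaluates channels only at such matrices.\<close>

lemma random_unitary_map_unit_mat:
  assumes V: "\<And>x. x < n \<Longrightarrow> V x \<in> carrier_mat d d" and ij: "i < d" "j < d" and rs: "r < d" "s < d"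
  shows "random_unitary_map d n V (unit_mat d i j) $$ (r, s)
    = (1 / of_nat n) * (\<Sum>x<n. V x $$ (r, i) * cnj (V x $$ (s, j)))"
proof -
  have "(V x * unit_mat d i j * mat_adjoint (V x)) $$ (r, s) = V x $$ (r, i) * cnj (V x $$ (s, j))"
    if x: "x < n" for x
  proof -
    note Vx = V[OF x]
    have E: "unit_mat d i j \<in> carrier_mat d d" by (simp add: unit_mat_def)
    have "(V x * unit_mat d i j * mat_adjoint (V x)) $$ (r, s)
      = (\<Sum>b<d. (\<Sum>a<d. V x $$ (r, a) * unit_mat d i j $$ (a, b)) * mat_adjoint (V x) $$ (b, s))"
      using rs by (simp add: mult_mat_index[OF mult_carrier_mat[OF Vx E] mat_adjoint_carrier[OF Vx]]
          mult_mat_index[OF Vx E] del: index_mult_mat(1) mat_adjoint_index)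
    also have "\<dots> = (\<Sum>b<d. (if b = j then V x $$ (r, i) else 0) * mat_adjoint (V x) $$ (b, s))"
    proof (intro sum.cong refl arg_cong2[where f = "(*)"])
      fix b assume "b \<in> {..<d}"
      then have "(\<Sum>a<d. V x $$ (r, a) * unit_mat d i j $$ (a, b))
        = (\<Sum>a<d. if a = i then (if b = j then V x $$ (r, a) else 0) else 0)"
        by (intro sum.cong) (auto simp: unit_mat_def)
      then show "(\<Sum>a<d. V x $$ (r, a) * unit_mat d i j $$ (a, b)) = (if b = j then V x $$ (r, i) else 0)"
        using ij by simp
    qed
    also have "\<dots> = (\<Sum>b<d. if b = j then V x $$ (r, i) * mat_adjoint (V x) $$ (b, s) else 0)"
      by (intro sum.cong) auto
    also have "\<dots> = V x $$ (r, i) * cnj (V x $$ (s, j))"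
      using ij rs Vx by simp
    finally show ?thesis .
  qed
  then show ?thesis using rs by (simp add: random_unitary_map_index del: index_mult_mat(1))
qed

text \<open>Passes from the summation order of \<open>tensor_map\<close> to the order of a matrix
  product in the tensor space: indices paired as (i, k) and (j, l), with the choice of unitaries
  outermost.\<close>

lemma sum_swap_pair:
  fixes f :: "'x \<Rightarrow> 'y \<Rightarrow> 'i \<Rightarrow> 'k \<Rightarrow> 'j \<Rightarrow> 'l \<Rightarrow> 'a::comm_monoid_add"
  shows "(\<Sum>i\<in>I. \<Sum>j\<in>J. \<Sum>k\<in>K. \<Sum>l\<in>L. \<Sum>x\<in>X. \<Sum>y\<in>Y. f x y i k j l)
    = (\<Sum>x\<in>X. \<Sum>y\<in>Y. \<Sum>i\<in>I. \<Sum>k\<in>K. \<Sum>j\<in>J. \<Sum>l\<in>L. f x y i k j l)"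
proof -
  \<comment> \<open>The index type is left general because the rule is applied to \<open>X\<close>
    and to \<open>Y\<close> in turn.\<close>
  have swap4: "(\<Sum>i\<in>I. \<Sum>k\<in>K. \<Sum>j\<in>J. \<Sum>l\<in>L. \<Sum>z\<in>Z. g z i k j l)
    = (\<Sum>z\<in>Z. \<Sum>i\<in>I. \<Sum>k\<in>K. \<Sum>j\<in>J. \<Sum>l\<in>L. g z i k j l)"
    for Z :: "'z set" and g :: "'z \<Rightarrow> 'i \<Rightarrow> 'k \<Rightarrow> 'j \<Rightarrow> 'l \<Rightarrow> 'a"
  proof -
    have "(\<Sum>z\<in>Z. \<Sum>i\<in>I. \<Sum>k\<in>K. \<Sum>j\<in>J. \<Sum>l\<in>L. g z i k j l)
      = (\<Sum>i\<in>I. \<Sum>z\<in>Z. \<Sum>k\<in>K. \<Sum>j\<in>J. \<Sum>l\<in>L. g z i k j l)" by (rule sum.swap)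
    also have "\<dots> = (\<Sum>i\<in>I. \<Sum>k\<in>K. \<Sum>z\<in>Z. \<Sum>j\<in>J. \<Sum>l\<in>L. g z i k j l)"
      by (intro sum.cong refl sum.swap)
    also have "\<dots> = (\<Sum>i\<in>I. \<Sum>k\<in>K. \<Sum>j\<in>J. \<Sum>z\<in>Z. \<Sum>l\<in>L. g z i k j l)"
      by (intro sum.cong refl sum.swap)
    also have "\<dots> = (\<Sum>i\<in>I. \<Sum>k\<in>K. \<Sum>j\<in>J. \<Sum>l\<in>L. \<Sum>z\<in>Z. g z i k j l)"
      by (intro sum.cong refl sum.swap)
    finally show ?thesis ..
  qed
  have "(\<Sum>i\<in>I. \<Sum>j\<in>J. \<Sum>k\<in>K. \<Sum>l\<in>L. \<Sum>x\<in>X. \<Sum>y\<in>Y. f x y i k j l)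
    = (\<Sum>i\<in>I. \<Sum>k\<in>K. \<Sum>j\<in>J. \<Sum>l\<in>L. \<Sum>x\<in>X. \<Sum>y\<in>Y. f x y i k j l)"
    by (intro sum.cong refl sum.swap)
  also have "\<dots> = (\<Sum>x\<in>X. \<Sum>i\<in>I. \<Sum>k\<in>K. \<Sum>j\<in>J. \<Sum>l\<in>L. \<Sum>y\<in>Y. f x y i k j l)"
    by (rule swap4)
  also have "\<dots> = (\<Sum>x\<in>X. \<Sum>y\<in>Y. \<Sum>i\<in>I. \<Sum>k\<in>K. \<Sum>j\<in>J. \<Sum>l\<in>L. f x y i k j l)"
    by (intro sum.cong refl swap4)
  finally show ?thesis .
qed

text \<open>Both sides expand to the same sum over pairs of unitaries and over row and column pairs.
  The number \<open>z\<close> encodes the pair of unitaries with indices \<open>z div m\<close> and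
  \<open>z mod m\<close>.\<close>

lemma tensor_random_unitary_map:
  assumes V: "\<And>x. x < n \<Longrightarrow> V x \<in> carrier_mat d d" and W: "\<And>y. y < m \<Longrightarrow> W y \<in> carrier_mat e e"
    and X: "X \<in> carrier_mat (d * e) (d * e)"
  shows "tensor_map d e (random_unitary_map d n V) (random_unitary_map e m W) X
    = random_unitary_map (d * e) (n * m) (\<lambda>z. kron (V (z div m)) (W (z mod m))) X"
    (is "?L = random_unitary_map _ _ ?K X")
proof (rule eq_matI)
  fix r s assume "r < dim_row (random_unitary_map (d * e) (n * m) ?K X)"
    "s < dim_col (random_unitary_map (d * e) (n * m) ?K X)"
  then have rs: "r < d * e" "s < d * e" by (auto simp: random_unitary_map_def)
  note dm = pair_index_div_mod[OF rs(1)] pair_index_div_mod[OF rs(2)]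
  let ?t = "\<lambda>x y i k j l. V x $$ (r div e, i) * W y $$ (r mod e, k) * X $$ (i * e + k, j * e + l)
      * cnj (V x $$ (s div e, j) * W y $$ (s mod e, l))"
  let ?c = "1 / of_nat n * (1 / of_nat m) :: complex"
  have "?L $$ (r, s) = (\<Sum>i<d. \<Sum>j<d. \<Sum>k<e. \<Sum>l<e. ?c * (\<Sum>x<n. \<Sum>y<m. ?t x y i k j l))"
  proof -
    have "X $$ (i * e + k, j * e + l) *
        kron (random_unitary_map d n V (unit_mat d i j)) (random_unitary_map e m W (unit_mat e k l)) $$ (r, s)
      = ?c * (\<Sum>x<n. \<Sum>y<m. ?t x y i k j l)"
      if "i < d" "j < d" "k < e" "l < e" for i j k l
    proof -
      have "kron (random_unitary_map d n V (unit_mat d i j)) (random_unitary_map e m W (unit_mat e k l)) $$ (r, s)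
        = ?c * (\<Sum>x<n. \<Sum>y<m. (V x $$ (r div e, i) * cnj (V x $$ (s div e, j))) *
            (W y $$ (r mod e, k) * cnj (W y $$ (s mod e, l))))"
        unfolding kron_index[OF random_unitary_map_carrier random_unitary_map_carrier rs]
        using random_unitary_map_unit_mat[OF V that(1,2) dm(1,3)] random_unitary_map_unit_mat[OF W that(3,4) dm(2,4)]
        by (simp add: sum_product[symmetric])
      then show ?thesis by (simp add: sum_distrib_left mult_ac)
    qed
    then show ?thesis using rs by (auto simp: tensor_map_def intro!: sum.cong)
  qed
  also have "\<dots> = ?c * (\<Sum>i<d. \<Sum>j<d. \<Sum>k<e. \<Sum>l<e. \<Sum>x<n. \<Sum>y<m. ?t x y i k j l)"
    by (simp only: sum_distrib_left)
  also have "(\<Sum>i<d. \<Sum>j<d. \<Sum>k<e. \<Sum>l<e. \<Sum>x<n. \<Sum>y<m. ?t x y i k j l)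
    = (\<Sum>x<n. \<Sum>y<m. \<Sum>i<d. \<Sum>k<e. \<Sum>j<d. \<Sum>l<e. ?t x y i k j l)"
    by (rule sum_swap_pair)
  \<comment> \<open>For fixed \<open>x\<close>, \<open>y\<close> the inner fourfold sum is one entry
    of a conjugation by the Kronecker product, with its two summation indices split into
    pairs.\<close>
  also have "\<dots> = (\<Sum>x<n. \<Sum>y<m. (?K (x * m + y) * X * mat_adjoint (?K (x * m + y))) $$ (r, s))"
  proof (intro sum.cong refl)
    fix x y assume "x \<in> {..<n}" "y \<in> {..<m}"
    then have xy: "x < n" "y < m" by auto
    let ?M = "kron (V x) (W y)"
    have M: "?M \<in> carrier_mat (d * e) (d * e)" using V W xy kron_carrier by blast
    have "(?M * X * mat_adjoint ?M) $$ (r, s)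
      = (\<Sum>q<d * e. (\<Sum>p<d * e. ?M $$ (r, p) * X $$ (p, q)) * cnj (?M $$ (s, q)))"
      using rs M by (simp add: mult_mat_index[OF mult_carrier_mat[OF M X] mat_adjoint_carrier[OF M]]
          mult_mat_index[OF M X] del: index_mult_mat(1))
    also have "\<dots> = (\<Sum>q<d * e. \<Sum>p<d * e. ?M $$ (r, p) * X $$ (p, q) * cnj (?M $$ (s, q)))"
      by (simp only: sum_distrib_right)
    also have "\<dots> = (\<Sum>p<d * e. \<Sum>q<d * e. ?M $$ (r, p) * X $$ (p, q) * cnj (?M $$ (s, q)))"
      by (rule sum.swap)
    also have "\<dots> = (\<Sum>i<d. \<Sum>k<e. \<Sum>j<d. \<Sum>l<e. ?t x y i k j l)"
      unfolding sum_lessThan_mult using rs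
      by (intro sum.cong refl) (simp add: kron_index[OF V[OF xy(1)] W[OF xy(2)]] pair_index_less)
    finally show "(\<Sum>i<d. \<Sum>k<e. \<Sum>j<d. \<Sum>l<e. ?t x y i k j l)
      = (?K (x * m + y) * X * mat_adjoint (?K (x * m + y))) $$ (r, s)"
      using xy by simp
  qed
  also have "\<dots> = (\<Sum>z<n * m. (?K z * X * mat_adjoint (?K z)) $$ (r, s))"
    by (rule sum_lessThan_mult[symmetric])
  also have "?c * \<dots> = random_unitary_map (d * e) (n * m) ?K X $$ (r, s)"
    using rs by (simp add: random_unitary_map_index del: index_mult_mat(1))
  finally show "?L $$ (r, s) = random_unitary_map (d * e) (n * m) ?K X $$ (r, s)" .
qed (auto simp: random_unitary_map_def tensor_map_def)

section \<open>Pure states and the maximally entangled vector\<close>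

text \<open>For a unit vector this is the pure state, the projection onto the line of
  \<open>u\<close>.\<close>

definition outer_mat :: "complex vec \<Rightarrow> complex mat" where
  "outer_mat u = mat (dim_vec u) (dim_vec u) (\<lambda>(r, s). u $ r * cnj (u $ s))"

lemma outer_mat_quadratic_form:
  assumes "u \<in> carrier_vec d" "v \<in> carrier_vec d"
  shows "(outer_mat u *\<^sub>v v) \<bullet>c v = complex_of_real ((cmod (u \<bullet>c v))\<^sup>2)"
proof -
  have "outer_mat u \<in> carrier_mat d d" using assms by (auto simp: outer_mat_def)
  then have "(outer_mat u *\<^sub>v v) \<bullet>c v = (\<Sum>r<d. \<Sum>s<d. (u $ r * cnj (v $ r)) * cnj (u $ s * cnj (v $ s)))"
    using assms by (subst quadratic_form_sum) (auto simp: outer_mat_def intro!: sum.cong)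
  also have "\<dots> = (u \<bullet>c v) * cnj (u \<bullet>c v)"
    using assms by (simp add: cscalar_prod_sum sum_product)
  finally show ?thesis by (simp only: complex_norm_square)
qed

lemma outer_mat_density:
  assumes u: "u \<in> carrier_vec d" "l2_norm u = 1"
  shows "outer_mat u \<in> density_ops d"
proof -
  have "mtrace (outer_mat u) = u \<bullet>c u"
    using u by (auto simp: mtrace_def outer_mat_def cscalar_prod_sum intro!: sum.cong)
  also have "\<dots> = 1" using u(2) by (simp add: l2_norm_square[symmetric])
  finally have "mtrace (outer_mat u) = 1" .
  moreover have "outer_mat u \<in> carrier_mat d d" using u by (auto simp: outer_mat_def)
  ultimately show ?thesis
    using outer_mat_quadratic_form[OF u(1)]
    by (auto simp: density_ops_def psd_mat_def less_eq_complex_def)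
qed

text \<open>Needed because a supremum over the empty set would be unspecified.\<close>

lemma density_ops_nonempty:
  assumes "0 < d"
  shows "density_ops d \<noteq> {}"
proof -
  have "(\<Sum>i<d. (cmod (unit_vec d 0 $ i))\<^sup>2) = (\<Sum>i<d. if i = 0 then 1 else 0)"
    by (intro sum.cong) (auto simp: unit_vec_def)
  then have "l2_norm (unit_vec d 0) = 1" using assms by (simp add: l2_norm_def)
  then show ?thesis using outer_mat_density[of "unit_vec d 0" d] by auto
qed

text \<open>The sum of e_i (x) e_i divided by sqrt d: the indices with equal quotient and remainder
  are the pairs (i, i).\<close>

definition max_entangled :: "nat \<Rightarrow> complex vec" where
  "max_entangled d = vec (d * d) (\<lambda>x. if x div d = x mod d then complex_of_real (1 / sqrt (real d)) else 0)"

lemma max_entangled_carrier [simp]: "max_entangled d \<in> carrier_vec (d * d)"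
  by (simp add: max_entangled_def)

lemma max_entangled_index:
  "i < d \<Longrightarrow> k < d \<Longrightarrow>
    max_entangled d $ (i * d + k) = (if i = k then complex_of_real (1 / sqrt (real d)) else 0)"
  by (simp add: max_entangled_def pair_index_less)

lemma max_entangled_l2_norm:
  assumes "0 < d"
  shows "l2_norm (max_entangled d) = 1"
proof -
  have "(\<Sum>x<d * d. (cmod (max_entangled d $ x))\<^sup>2) = (\<Sum>i<d. \<Sum>k<d. if i = k then 1 / real d else 0)"
    unfolding sum_lessThan_mult
    by (intro sum.cong refl) (auto simp: max_entangled_index norm_divide power_divide)
  also have "\<dots> = 1" using assms by simp
  finally show ?thesis by (simp add: l2_norm_def max_entangled_def)
qed

text \<open>Arrange the coordinates of a vector as a d by d matrix M. Then U (x) cnj U acts as M to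
  U M U^dagger, and this vector corresponds to a multiple of the identity.\<close>

lemma kron_cnj_max_entangled:
  assumes U: "unitary_mat d U"
  shows "kron U (map_mat cnj U) *\<^sub>v max_entangled d = max_entangled d"
proof (rule eq_vecI)
  note Uc = unitary_matD[OF U]
  have cU: "map_mat cnj U \<in> carrier_mat d d" using Uc(1) by simp
  note K = kron_carrier[OF Uc(1) cU]
  fix r assume "r < dim_vec (max_entangled d)"
  then have r: "r < d * d" by (simp add: max_entangled_def)
  note dm = pair_index_div_mod[OF r]
  let ?c = "complex_of_real (1 / sqrt (real d))"
  have "(kron U (map_mat cnj U) *\<^sub>v max_entangled d) $ r
    = (\<Sum>x<d * d. kron U (map_mat cnj U) $$ (r, x) * max_entangled d $ x)"
    by (rule mult_mat_vec_index[OF K max_entangled_carrier r])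
  also have "\<dots> = (\<Sum>a<d. \<Sum>k<d. if a = k then U $$ (r div d, a) * cnj (U $$ (r mod d, a)) * ?c else 0)"
    unfolding sum_lessThan_mult using r dm Uc(1)
    by (intro sum.cong refl) (auto simp: kron_index[OF Uc(1) cU] pair_index_less max_entangled_index)
  also have "\<dots> = (\<Sum>a<d. U $$ (r div d, a) * mat_adjoint U $$ (a, r mod d)) * ?c"
    using Uc(1) dm by (auto simp: sum_distrib_right sum_divide_distrib intro!: sum.cong)
  also have "(\<Sum>a<d. U $$ (r div d, a) * mat_adjoint U $$ (a, r mod d)) = (U * mat_adjoint U) $$ (r div d, r mod d)"
    by (rule mult_mat_index[OF Uc(1) mat_adjoint_carrier[OF Uc(1)] dm, symmetric])
  also have "\<dots> * ?c = max_entangled d $ r"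
    unfolding Uc(2) using dm r by (simp add: max_entangled_def)
  finally show "(kron U (map_mat cnj U) *\<^sub>v max_entangled d) $ r = max_entangled d $ r" .
qed (use unitary_matD(1)[OF U] in \<open>auto simp: max_entangled_def kron_def\<close>)

text \<open>
  The maximally entangled state is fixed by the \<open>n\<close> diagonal terms \<open>V\<^sub>x \<otimes> cnj V\<^sub>x\<close> among the
  \<open>n\<^sup>2\<close> unitaries of the product channel, hence the overlap \<open>n / n\<^sup>2\<close>.
\<close>

lemma tensor_cnj_max_output_norm_ge:
  assumes V: "\<And>i. i < n \<Longrightarrow> unitary_mat d (V i)" and n: "0 < n" and d: "0 < d" and p: "1 < p"
  shows "1 / real n \<le> max_output_norm p (d * d)
    (tensor_map d d (random_unitary_map d n V) (random_unitary_map d n (\<lambda>i. map_mat cnj (V i))))"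
proof -
  define K where "K z = kron (V (z div n)) (map_mat cnj (V (z mod n)))" for z
  let ?T = "tensor_map d d (random_unitary_map d n V) (random_unitary_map d n (\<lambda>i. map_mat cnj (V i)))"
  let ?R = "random_unitary_map (d * d) (n * n) K"
  have Vc: "V i \<in> carrier_mat d d" if "i < n" for i using unitary_matD(1)[OF V[OF that]] .
  have T: "?T \<rho> = ?R \<rho>" if "\<rho> \<in> density_ops (d * d)" for \<rho>
    unfolding K_def using Vc density_opsD(1)[OF that] by (intro tensor_random_unitary_map) auto
  have K: "unitary_mat (d * d) (K z)" if "z < n * n" for z
    unfolding K_def using pair_index_div_mod[OF that] by (intro kron_unitary unitary_mat_cnj V)
  have dens: "?R \<rho> \<in> density_ops (d * d)" if "\<rho> \<in> density_ops (d * d)" for \<rho>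
    using random_unitary_map_density[OF that K] n by simp
  let ?u = "max_entangled d"
  let ?\<rho> = "outer_mat ?u"
  have u1: "l2_norm ?u = 1" by (rule max_entangled_l2_norm[OF d])
  have \<rho>: "?\<rho> \<in> density_ops (d * d)" by (rule outer_mat_density[OF max_entangled_carrier u1])
  \<comment> \<open>The squared overlap contributed by the \<open>z\<close>-th unitary. These
    numbers are nonnegative, so all but the diagonal ones may be dropped below.\<close>
  define g where "g z = (cmod (?u \<bullet>c (mat_adjoint (K z) *\<^sub>v ?u)))\<^sup>2" for z
  have "(?R ?\<rho> *\<^sub>v ?u) \<bullet>c ?u = (1 / of_nat (n * n)) *
      (\<Sum>z<n * n. (?\<rho> *\<^sub>v (mat_adjoint (K z) *\<^sub>v ?u)) \<bullet>c (mat_adjoint (K z) *\<^sub>v ?u))"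
    using unitary_matD(1)[OF K] by (intro random_unitary_map_quadratic_form density_opsD(1)[OF \<rho>] max_entangled_carrier)
  also have "\<dots> = (1 / of_nat (n * n)) * (\<Sum>z<n * n. complex_of_real (g z))"
    unfolding g_def
    by (intro arg_cong2[where f = "(*)"] sum.cong refl outer_mat_quadratic_form[of _ "d * d"] max_entangled_carrier
        mult_mat_vec_carrier[OF mat_adjoint_carrier[OF unitary_matD(1)[OF K]]]) auto
  also have "\<dots> = complex_of_real ((\<Sum>z<n * n. g z) / real (n * n))" by simp
  finally have form: "(?R ?\<rho> *\<^sub>v ?u) \<bullet>c ?u = complex_of_real ((\<Sum>z<n * n. g z) / real (n * n))" .
  \<comment> \<open>\<open>x * n + x\<close> encodes the pair (x, x). The adjoint of V_x (x) cnj V_x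
    has the same shape with the unitary V_x^dagger, so it fixes the vector too.\<close>
  have g1: "g (x * n + x) = 1" if x: "x < n" for x
  proof -
    have "mat_adjoint (K (x * n + x)) = kron (mat_adjoint (V x)) (map_mat cnj (mat_adjoint (V x)))"
      using x by (simp add: K_def mat_adjoint_kron map_mat_cnj_adjoint)
    then have "mat_adjoint (K (x * n + x)) *\<^sub>v ?u = ?u"
      using kron_cnj_max_entangled[OF unitary_mat_adjoint[OF V[OF x]]] by simp
    then show ?thesis using l2_norm_square[of ?u] u1 by (simp add: g_def)
  qed
  have "real n = (\<Sum>x<n. g (x * n + x))" using g1 by simp
  also have "\<dots> \<le> (\<Sum>x<n. \<Sum>y<n. g (x * n + y))"
    by (intro sum_mono member_le_sum[where f = "\<lambda>y. g (_ * n + y)"]) (auto simp: g_def)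
  also have "\<dots> = (\<Sum>z<n * n. g z)" by (rule sum_lessThan_mult[symmetric])
  finally have "1 / real n \<le> (\<Sum>z<n * n. g z) / real (n * n)"
    using n by (simp add: field_simps)
  then have "complex_of_real (1 / real n) \<le> (?R ?\<rho> *\<^sub>v ?u) \<bullet>c ?u"
    unfolding form by (simp only: less_eq_complex_def Re_complex_of_real Im_complex_of_real)
  then have "1 / real n \<le> schatten_norm p (?R ?\<rho>)"
    by (intro density_schatten_norm_ge[OF dens[OF \<rho>] p max_entangled_carrier u1]) auto
  also have "\<dots> = schatten_norm p (?T ?\<rho>)" using T[OF \<rho>] by simp
  also have "\<dots> \<le> max_output_norm p (d * d) ?T"
    unfolding max_output_norm_def
    \<comment> \<open>Outputs are states, so 1 bounds the set and each member lies below the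
      supremum.\<close>
    using density_schatten_norm_le_1[OF dens p] T
    by (intro cSUP_upper \<rho> bdd_aboveI2[of _ _ 1]) auto
  finally show ?thesis .
qed

text \<open>Nonnegativity is recorded as well because the bounds for the two channels are multiplied
  later.\<close>

lemma max_output_norm_le:
  assumes "0 < d" "\<And>\<rho>. \<rho> \<in> density_ops d \<Longrightarrow> schatten_norm p (\<Phi> \<rho>) \<le> c"
  shows "max_output_norm p d \<Phi> \<le> c" "0 \<le> max_output_norm p d \<Phi>"
proof -
  show "max_output_norm p d \<Phi> \<le> c"
    unfolding max_output_norm_def using assms density_ops_nonempty by (intro cSUP_least) auto
  obtain \<rho> where \<rho>: "\<rho> \<in> density_ops d" using density_ops_nonempty[OF assms(1)] by auto
  have "0 \<le> schatten_norm p (\<Phi> \<rho>)" by (rule schatten_norm_nonneg)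
  also have "\<dots> \<le> max_output_norm p d \<Phi>"
    unfolding max_output_norm_def using assms(2) by (intro cSUP_upper \<rho> bdd_aboveI2[of _ _ c]) auto
  finally show "0 \<le> max_output_norm p d \<Phi>" .
qed

section \<open>Asymptotics in the dimension and conclusion\<close>

text \<open>At d = 1 the logarithm vanishes and the number is 0, hence the bound 2.\<close>

lemma num_unitaries_pos:
  assumes "0 < \<epsilon>" "2 \<le> d"
  shows "0 < num_unitaries \<epsilon> d"
  using assms by (simp add: num_unitaries_def)

text \<open>Up to constants the leading term is d^(1 - q) * ln d, and a negative power beats the
  logarithm.\<close>

lemma num_unitaries_powr_tendsto_0:
  assumes \<epsilon>: "0 < \<epsilon>" and q: "1 < q"
  shows "(\<lambda>d. real (num_unitaries \<epsilon> d) * ((1 + \<epsilon>) / real d) powr q) \<longlonglongrightarrow> 0"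
proof (rule tendsto_sandwich[OF always_eventually _ tendsto_const])
  show "\<forall>d. 0 \<le> real (num_unitaries \<epsilon> d) * ((1 + \<epsilon>) / real d) powr q" by simp
  \<comment> \<open>The ceiling costs at most 1, and for d at least 1 its argument is nonnegative,
    so \<open>nat\<close> truncates nothing.\<close>
  have le: "real (num_unitaries \<epsilon> d) \<le> 134 * real d * ln (real d) / \<epsilon>\<^sup>2 + 1" if "1 \<le> d" for d
  proof -
    have "0 \<le> 134 * real d * ln (real d) / \<epsilon>\<^sup>2" using that by simp
    then show ?thesis unfolding num_unitaries_def by linarith
  qed
  show "\<forall>\<^sub>F d in sequentially. real (num_unitaries \<epsilon> d) * ((1 + \<epsilon>) / real d) powr q
    \<le> (134 * real d * ln (real d) / \<epsilon>\<^sup>2 + 1) * ((1 + \<epsilon>) / real d) powr q"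
    using eventually_ge_at_top[of 1]
  proof eventually_elim
    case (elim d)
    show ?case using le[OF elim] by (rule mult_right_mono) simp
  qed
  show "(\<lambda>d. (134 * real d * ln (real d) / \<epsilon>\<^sup>2 + 1) * ((1 + \<epsilon>) / real d) powr q) \<longlonglongrightarrow> 0"
    using assms by real_asymp
qed

text \<open>\<open>n\<close> is defined for every dimension, so the limit is stated along all of
  them, while the guard \<open>d \<in> D\<close> confines the inequalities to the family.\<close>

theorem mainTheorem1:
  fixes \<epsilon> :: real and D :: "nat set" and V :: "nat \<Rightarrow> nat \<Rightarrow> complex mat"
    and n :: "nat \<Rightarrow> nat" and N Nbar :: "nat \<Rightarrow> complex mat \<Rightarrow> complex mat"
  assumes "0 < \<epsilon>" and "\<epsilon> < 1"
    and "infinite D" and "\<And>d. d \<in> D \<Longrightarrow> 0 < d"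
    and n_def: "\<And>d. n d = num_unitaries \<epsilon> d"
    and "\<And>d i. d \<in> D \<Longrightarrow> i < n d \<Longrightarrow> unitary_mat d (V d i)"
    and N_def: "\<And>d. N d = random_unitary_map d (n d) (V d)"
    and Nbar_def: "\<And>d. Nbar d = random_unitary_map d (n d) (\<lambda>i. map_mat cnj (V d i))"
    and "\<And>d. d \<in> D \<Longrightarrow> randomizing \<epsilon> d (N d)"
  shows "\<forall>p>2.
    (\<forall>\<^sub>F d in sequentially. d \<in> D \<longrightarrow>
       max_output_norm p d (N d) * max_output_norm p d (Nbar d)
         \<le> ((1 + \<epsilon>) / real d) powr (2 - 2 / p)
     \<and> ((1 + \<epsilon>) / real d) powr (2 - 2 / p) < 1 / real (n d)
     \<and> 1 / real (n d) \<le> max_output_norm p (d * d) (tensor_map d d (N d) (Nbar d)))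
    \<and> (\<lambda>d. real (n d) * ((1 + \<epsilon>) / real d) powr (2 - 2 / p)) \<longlonglongrightarrow> 0
    \<and> (\<forall>\<^sub>F d in sequentially. d \<in> D \<longrightarrow>
         max_output_norm p d (N d) * max_output_norm p d (Nbar d)
           < max_output_norm p (d * d) (tensor_map d d (N d) (Nbar d)))"
proof (intro allI impI)
  fix p :: real assume p: "2 < p"
  define q where "q = 2 - 2 / p"
  have q: "1 < q" using p by (simp add: q_def field_simps)
  have lim: "(\<lambda>d. real (n d) * ((1 + \<epsilon>) / real d) powr q) \<longlonglongrightarrow> 0"
    unfolding n_def by (rule num_unitaries_powr_tendsto_0[OF assms(1) q])
  \<comment> \<open>The limit is used only through this: dividing by the positive \<open>n d\<close>
    gives the strict middle inequality.\<close>
  have "\<forall>\<^sub>F d in sequentially. real (n d) * ((1 + \<epsilon>) / real d) powr q < 1"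
    using order_tendstoD(2)[OF lim, of 1] by simp
  then have chain: "\<forall>\<^sub>F d in sequentially. d \<in> D \<longrightarrow>
       max_output_norm p d (N d) * max_output_norm p d (Nbar d) \<le> ((1 + \<epsilon>) / real d) powr q
     \<and> ((1 + \<epsilon>) / real d) powr q < 1 / real (n d)
     \<and> 1 / real (n d) \<le> max_output_norm p (d * d) (tensor_map d d (N d) (Nbar d))"
    using eventually_ge_at_top[of 2]
  proof eventually_elim
    case (elim d)
    show ?case
    proof (intro impI conjI)
      assume d: "d \<in> D"
      note V = assms(6)[OF d]
      have n: "0 < n d" using num_unitaries_pos[OF assms(1) elim(2)] by (simp add: n_def)
      have p1: "1 < p" using p by simp
      have d0: "0 < d" using elim(2) by simp
      note le = randomizing_cnj_schatten_norm_le[OF V n p1 assms(9)[OF d, unfolded N_def]]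
      note leN = max_output_norm_le[OF d0 le(1), folded N_def]
        and leNbar = max_output_norm_le[OF d0 le(2), folded Nbar_def]
      have "max_output_norm p d (N d) * max_output_norm p d (Nbar d)
        \<le> ((1 + \<epsilon>) / real d) powr (1 - 1 / p) * ((1 + \<epsilon>) / real d) powr (1 - 1 / p)"
        using leN leNbar by (intro mult_mono) auto
      \<comment> \<open>The two exponents 1 - 1/p add up to \<open>q\<close>.\<close>
      also have "\<dots> = ((1 + \<epsilon>) / real d) powr q"
        by (simp add: powr_add[symmetric] q_def)
      finally show "max_output_norm p d (N d) * max_output_norm p d (Nbar d) \<le> ((1 + \<epsilon>) / real d) powr q" .
      show "((1 + \<epsilon>) / real d) powr q < 1 / real (n d)"
        using elim(1) n by (simp add: pos_less_divide_eq mult.commute)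
      show "1 / real (n d) \<le> max_output_norm p (d * d) (tensor_map d d (N d) (Nbar d))"
        unfolding N_def Nbar_def by (rule tensor_cnj_max_output_norm_ge[OF V n d0 p1])
    qed
  qed
  moreover from chain have "\<forall>\<^sub>F d in sequentially. d \<in> D \<longrightarrow>
      max_output_norm p d (N d) * max_output_norm p d (Nbar d)
        < max_output_norm p (d * d) (tensor_map d d (N d) (Nbar d))"
    by (rule eventually_mono) (blast intro: le_less_trans less_le_trans)
  ultimately show "(\<forall>\<^sub>F d in sequentially. d \<in> D \<longrightarrow>
       max_output_norm p d (N d) * max_output_norm p d (Nbar d)
         \<le> ((1 + \<epsilon>) / real d) powr (2 - 2 / p)
     \<and> ((1 + \<epsilon>) / real d) powr (2 - 2 / p) < 1 / real (n d)
     \<and> 1 / real (n d) \<le> max_output_norm p (d * d) (tensor_map d d (N d) (Nbar d)))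
    \<and> (\<lambda>d. real (n d) * ((1 + \<epsilon>) / real d) powr (2 - 2 / p)) \<longlonglongrightarrow> 0
    \<and> (\<forall>\<^sub>F d in sequentially. d \<in> D \<longrightarrow>
         max_output_norm p d (N d) * max_output_norm p d (Nbar d)
           < max_output_norm p (d * d) (tensor_map d d (N d) (Nbar d)))"
    using lim unfolding q_def by blast
qed

end
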